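(* In the setting described in the context, assume that the maximal edge length is sufficiently small and that the coefficients $C_{\vec n}$ and $C_{\vec m}$ are constant on each edge. Then for all $(\vec\lambda,\vec\phi)\in V_{\vec\lambda}\times V_{\vec\lambda}$, \[ L(\vec\lambda,\vec\lambda)+L(\vec\phi,\vec\phi)\lesssim A((\vec\lambda,\vec\phi),(\vec\lambda,\vec\phi))\lesssim L(\vec\lambda,\vec\lambda)+L(\vec\phi,\vec\phi), \] where the hidden constants depend only on the reciprocal of \[ \lambda_{\min}=\min_{\vec\mu\in V_{\vec\lambda}\setminus\{0\}}\frac{L(\vec\mu,\vec\mu)}{M(\vec\mu,\vec\mu)}. \]
   Context: $\mathcal G=(\mathcal N,\mathcal E)$ is a finite connected graph embedded in $\mathbb R^3$: nodes are distinct points, each edge $\mathfrak e$ is the straight segment joining two distinct nodes $\mathfrak n_k,\mathfrak n_\ell$ ($k<\ell$), with length $h_{\mathfrak e}$, direction $\vec i_{\mathfrak e}=(\mathfrak n_\ell-\mathfrak n_k)/h_{\mathfrak e}$, scalar normals $\nu_{\mathfrak e}(\mathfrak n_k)=-1$, $\nu_{\mathfrak e}(\mathfrak n_\ell)=+1$; $x$ is arclength on $\mathfrak e$ increasing along $\vec i_{\mathfrak e}$, $\partial_x$ its derivative, $\times$ the cross product. $C_{\vec n},C_{\vec m}$ are symmetric $\mathbb R^{3\times3}$-valued coefficients with uniform bounds $\alpha_{\vec n}|\xi|^2\le(C_{\vec n}\xi)\cdot\xi\le\beta_{\vec n}|\xi|^2$, $\alpha_{\vec m}|\xi|^2\le(C_{\vec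 m}\xi)\cdot\xi\le\beta_{\vec m}|\xi|^2$ ($0<\alpha,\beta<\infty$), and for each edge there is a right-handed orthonormal basis $\{\vec i_{\mathfrak e},\vec j_{\mathfrak e},\vec k_{\mathfrak e}\}$ (principal axes of the beam cross section) in which $C_{\vec n}$ and $C_{\vec m}$ are diagonal. $(\vec v,\vec w)_{\mathfrak e}=\int_{\mathfrak e}\vec v\cdot\vec w\,\mathrm d\sigma$; $\langle\vec a,\vec b\rangle_{\mathfrak e}=\sum_{\mathfrak n\text{ endpoint of }\mathfrak e}\vec a(\mathfrak n)\cdot\vec b(\mathfrak n)$, also for nodal quantities. Local solver: for an edge $\mathfrak e$ and nodal data $\vec u_{\mathfrak n},\vec r_{\mathfrak n}\in\mathbb R^3$ at its endpoints, $\vec N_{\mathfrak e}(\vec u_{\mathfrak n},\vec r_{\mathfrak n}),\vec M_{\mathfrak e}(\vec u_{\mathfrak n},\vec r_{\mathfrak n})$ denote the components $\vec n_{\mathfrak e},\vec m_{\mathfrak e}\in(H^1(\mathfrak e))^3$ of the unique $\vec u_{\mathfrak e},\vec r_{\mathfrak e}\in(L^2(\mathfrak e))^3$, $\vec n_{\mathfrak e},\vec m_{\mathfrak e}\in(H^1(\mathfrak e))^3$ with, for all $\vec p,\vec q\in(H^1(\mathfrak e))^3$, $\vec v,\vec w\in(L^2(\mathfrak e))^3$: $-(C_{\vec n}^{-1}\vec n_{\mathfrak e},\vec p)_{\mathfrak e}+(\vec u_{\mathfrak e},\partial_x\vec p)_{\mathfrak e}-(\vec i_{\mathfrak e}\times\vec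 r_{\mathfrak e},\vec p)_{\mathfrak e}=\langle\vec u_{\mathfrak n},\vec p\nu_{\mathfrak e}\rangle_{\mathfrak e}$; $-(C_{\vec m}^{-1}\vec m_{\mathfrak e},\vec q)_{\mathfrak e}+(\vec r_{\mathfrak e},\partial_x\vec q)_{\mathfrak e}=\langle\vec r_{\mathfrak n},\vec q\nu_{\mathfrak e}\rangle_{\mathfrak e}$; $(\partial_x\vec n_{\mathfrak e},\vec v)_{\mathfrak e}=0$; $(\vec i_{\mathfrak e}\times\vec n_{\mathfrak e},\vec w)_{\mathfrak e}+(\partial_x\vec m_{\mathfrak e},\vec w)_{\mathfrak e}=0$. A nonempty set $\mathcal N_{\mathrm D}\subset\mathcal N$ of Dirichlet nodes is fixed and $V_{\vec\lambda}$ is the space of maps $\vec\lambda:\mathcal N\to\mathbb R^3$ with $\vec\lambda_{\mathfrak n}=0$ for $\mathfrak n\in\mathcal N_{\mathrm D}$. With $[\![q_{\mathfrak e}]\!]_{\mathfrak n}=\sum_{\mathfrak e\text{ adjacent to }\mathfrak n}q_{\mathfrak e}(\mathfrak n)$, define $A((\vec\lambda,\vec\phi),(\vec\mu,\vec\psi))=-\sum_{\mathfrak n\in\mathcal N\setminus\mathcal N_{\mathrm D}}\big[[\![\vec N_{\mathfrak e}(\vec\lambda_{\mathfrak n},\vec\phi_{\mathfrak n})\nu_{\mathfrak e}]\!]_{\mathfrak n}\cdot\vec\mu_{\mathfrak n}+[\![\vec M_{\mathfrak e}(\vec\lambda_{\mathfrak n},\vec\phi_{\mathfrak n})\nu_{\mathfrak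 e}]\!]_{\mathfrak n}\cdot\vec\psi_{\mathfrak n}\big]$, where the local solver on $\mathfrak e$ is fed the values of $\vec\lambda,\vec\phi$ at the endpoints of $\mathfrak e$. For $\vec\lambda,\vec\mu\in V_{\vec\lambda}$ define $M(\vec\lambda,\vec\mu)=\sum_{\mathfrak n\in\mathcal N}\frac12\sum_{\mathfrak e\text{ adjacent to }\mathfrak n}h_{\mathfrak e}\,\vec\lambda_{\mathfrak n}\cdot\vec\mu_{\mathfrak n}$ and $L(\vec\lambda,\vec\mu)=\sum_{\mathfrak n\in\mathcal N}\frac12\sum_{\mathfrak e=(\mathfrak n,\mathfrak n')\text{ adjacent to }\mathfrak n}\frac{(\vec\lambda_{\mathfrak n}-\vec\lambda_{\mathfrak n'})\cdot(\vec\mu_{\mathfrak n}-\vec\mu_{\mathfrak n'})}{h_{\mathfrak e}}$. Notation $a\lesssim b$: $a\le Cb$ with $C>0$ possibly depending on the coefficients $C_{\vec n},C_{\vec m}$ but independent of the edge lengths. *)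

theory Defs
  imports "HOL-Analysis.Analysis"
begin

type_synonym vec3 = "real^3"
type_synonym edge = "vec3 \<times> vec3"   \<comment> \<open>oriented edge (n_k, n_l): from n_k to n_l\<close>

section \<open>Edge geometry\<close>

definition edge_len :: "edge \<Rightarrow> real" where
  "edge_len e = norm (snd e - fst e)"

definition edge_dir :: "edge \<Rightarrow> vec3" where
  "edge_dir e = (1 / edge_len e) *\<^sub>R (snd e - fst e)"

section \<open>Function spaces on an edge, parametrised by arclength x in [0,h]\<close>

definition L2 :: "real \<Rightarrow> (real \<Rightarrow> vec3) \<Rightarrow> bool" where
  "L2 h f \<longleftrightarrow> set_borel_measurable lborel {0..h} f \<and>
              set_integrable lborel {0..h} (\<lambda>x. (norm (f x))\<^sup>2)"

text \<open>p is in H^1(0,h) with weak derivative p' (p is the continuous representative).\<close>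
definition H1d :: "real \<Rightarrow> (real \<Rightarrow> vec3) \<Rightarrow> (real \<Rightarrow> vec3) \<Rightarrow> bool" where
  "H1d h p p' \<longleftrightarrow> L2 h p' \<and> set_integrable lborel {0..h} p' \<and>
                  (\<forall>x\<in>{0..h}. p x = p 0 + (LINT t:{0..x}|lborel. p' t))"

definition H1 :: "real \<Rightarrow> (real \<Rightarrow> vec3) \<Rightarrow> bool" where
  "H1 h p \<longleftrightarrow> (\<exists>p'. H1d h p p')"

text \<open>The L^2(e) inner product.\<close>
definition ip :: "real \<Rightarrow> (real \<Rightarrow> vec3) \<Rightarrow> (real \<Rightarrow> vec3) \<Rightarrow> real" where
  "ip h v w = (LINT x:{0..h}|lborel. v x \<bullet> w x)"

section \<open>Local solver (coefficients constant on the edge)\<close>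

text \<open>Weak formulation on an edge of length h, direction i, coefficients Cn, Cm,
  nodal data ua, ra at the start node (normal -1, x = 0) and ub, rb at the end node
  (normal +1, x = h).\<close>
definition local_sol ::
  "real \<Rightarrow> vec3 \<Rightarrow> real^3^3 \<Rightarrow> real^3^3 \<Rightarrow> vec3 \<Rightarrow> vec3 \<Rightarrow> vec3 \<Rightarrow> vec3 \<Rightarrow>
   (real \<Rightarrow> vec3) \<Rightarrow> (real \<Rightarrow> vec3) \<Rightarrow> (real \<Rightarrow> vec3) \<Rightarrow> (real \<Rightarrow> vec3) \<Rightarrow> bool" where
  "local_sol h i Cn Cm ua ub ra rb u r n m \<longleftrightarrow>
     L2 h u \<and> L2 h r \<and> H1 h n \<and> H1 h m \<and>
     (\<forall>p p'. H1d h p p' \<longrightarrow>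
        - ip h (\<lambda>x. matrix_inv Cn *v n x) p + ip h u p' - ip h (\<lambda>x. cross3 i (r x)) p
        = ub \<bullet> p h - ua \<bullet> p 0) \<and>
     (\<forall>q q'. H1d h q q' \<longrightarrow>
        - ip h (\<lambda>x. matrix_inv Cm *v m x) q + ip h r q'
        = rb \<bullet> q h - ra \<bullet> q 0) \<and>
     (\<forall>n'. H1d h n n' \<longrightarrow> (\<forall>v. L2 h v \<longrightarrow> ip h n' v = 0)) \<and>
     (\<forall>m'. H1d h m m' \<longrightarrow> (\<forall>w. L2 h w \<longrightarrow> ip h (\<lambda>x. cross3 i (n x)) w + ip h m' w = 0))"

text \<open>Values of (N_e, M_e) at the point x = t of the edge e (t = 0: start node, t = h: end node),
  for nodal data given by the maps lam, phi.\<close>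
definition NM_at ::
  "(edge \<Rightarrow> real^3^3) \<Rightarrow> (edge \<Rightarrow> real^3^3) \<Rightarrow> edge \<Rightarrow> (vec3 \<Rightarrow> vec3) \<Rightarrow> (vec3 \<Rightarrow> vec3)
   \<Rightarrow> real \<Rightarrow> vec3 \<times> vec3" where
  "NM_at Cn Cm e lam phi t =
     (THE nm. \<exists>u r n m. local_sol (edge_len e) (edge_dir e) (Cn e) (Cm e)
                          (lam (fst e)) (lam (snd e)) (phi (fst e)) (phi (snd e)) u r n m
                        \<and> nm = (n t, m t))"

text \<open>Jump [[q_e nu_e]]_nd of the traces of N (resp. M) at the node nd.\<close>
definition jumpN :: "(edge \<Rightarrow> real^3^3) \<Rightarrow> (edge \<Rightarrow> real^3^3) \<Rightarrow> edge set
   \<Rightarrow> (vec3 \<Rightarrow> vec3) \<Rightarrow> (vec3 \<Rightarrow> vec3) \<Rightarrow> vec3 \<Rightarrow> vec3" where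
  "jumpN Cn Cm E lam phi nd =
     (\<Sum>e\<in>{e\<in>E. fst e = nd \<or> snd e = nd}.
        if fst e = nd then - fst (NM_at Cn Cm e lam phi 0)
        else fst (NM_at Cn Cm e lam phi (edge_len e)))"

definition jumpM :: "(edge \<Rightarrow> real^3^3) \<Rightarrow> (edge \<Rightarrow> real^3^3) \<Rightarrow> edge set
   \<Rightarrow> (vec3 \<Rightarrow> vec3) \<Rightarrow> (vec3 \<Rightarrow> vec3) \<Rightarrow> vec3 \<Rightarrow> vec3" where
  "jumpM Cn Cm E lam phi nd =
     (\<Sum>e\<in>{e\<in>E. fst e = nd \<or> snd e = nd}.
        if fst e = nd then - snd (NM_at Cn Cm e lam phi 0)
        else snd (NM_at Cn Cm e lam phi (edge_len e)))"

definition bilinA :: "(edge \<Rightarrow> real^3^3) \<Rightarrow> (edge \<Rightarrow> real^3^3) \<Rightarrow> vec3 set \<Rightarrow> edge set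
   \<Rightarrow> vec3 set \<Rightarrow> (vec3 \<Rightarrow> vec3) \<Rightarrow> (vec3 \<Rightarrow> vec3) \<Rightarrow> (vec3 \<Rightarrow> vec3) \<Rightarrow> (vec3 \<Rightarrow> vec3) \<Rightarrow> real"
  where
  "bilinA Cn Cm N E ND lam phi mu psi =
     - (\<Sum>nd\<in>N - ND. jumpN Cn Cm E lam phi nd \<bullet> mu nd + jumpM Cn Cm E lam phi nd \<bullet> psi nd)"

section \<open>Discrete mass and stiffness forms, space V, and lambda_min\<close>

definition inV :: "vec3 set \<Rightarrow> (vec3 \<Rightarrow> vec3) \<Rightarrow> bool" where
  "inV ND lam \<longleftrightarrow> (\<forall>nd\<in>ND. lam nd = 0)"

definition other_end :: "edge \<Rightarrow> vec3 \<Rightarrow> vec3" where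
  "other_end e nd = (if fst e = nd then snd e else fst e)"

definition massM :: "vec3 set \<Rightarrow> edge set \<Rightarrow> (vec3 \<Rightarrow> vec3) \<Rightarrow> (vec3 \<Rightarrow> vec3) \<Rightarrow> real" where
  "massM N E lam mu =
     (\<Sum>nd\<in>N. (1/2) * (\<Sum>e\<in>{e\<in>E. fst e = nd \<or> snd e = nd}. edge_len e) * (lam nd \<bullet> mu nd))"

definition stiffL :: "vec3 set \<Rightarrow> edge set \<Rightarrow> (vec3 \<Rightarrow> vec3) \<Rightarrow> (vec3 \<Rightarrow> vec3) \<Rightarrow> real" where
  "stiffL N E lam mu =
     (\<Sum>nd\<in>N. (1/2) * (\<Sum>e\<in>{e\<in>E. fst e = nd \<or> snd e = nd}.
        ((lam nd - lam (other_end e nd)) \<bullet> (mu nd - mu (other_end e nd))) / edge_len e))"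

definition lam_min :: "vec3 set \<Rightarrow> edge set \<Rightarrow> vec3 set \<Rightarrow> real" where
  "lam_min N E ND =
     Inf {stiffL N E mu mu / massM N E mu mu | mu. inV ND mu \<and> (\<exists>nd\<in>N. mu nd \<noteq> 0)}"

section \<open>Standing assumptions\<close>

definition coeff_ok :: "real^3^3 \<Rightarrow> real \<Rightarrow> real \<Rightarrow> bool" where
  "coeff_ok C \<alpha> \<beta> \<longleftrightarrow> transpose C = C \<and>
     (\<forall>\<xi>. \<alpha> * (norm \<xi>)\<^sup>2 \<le> (C *v \<xi>) \<bullet> \<xi> \<and> (C *v \<xi>) \<bullet> \<xi> \<le> \<beta> * (norm \<xi>)\<^sup>2)"

text \<open>C is diagonal in the orthonormal basis {i,j,k}.\<close>
definition diag_in :: "real^3^3 \<Rightarrow> vec3 \<Rightarrow> vec3 \<Rightarrow> vec3 \<Rightarrow> bool" where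
  "diag_in C i j k \<longleftrightarrow>
     (\<forall>b1\<in>{i,j,k}. \<forall>b2\<in>{i,j,k}. b1 \<noteq> b2 \<longrightarrow> (C *v b1) \<bullet> b2 = 0)"

definition beam_graph ::
  "vec3 set \<Rightarrow> edge set \<Rightarrow> vec3 set \<Rightarrow> (edge \<Rightarrow> real^3^3) \<Rightarrow> (edge \<Rightarrow> real^3^3)
   \<Rightarrow> real \<Rightarrow> real \<Rightarrow> real \<Rightarrow> real \<Rightarrow> bool" where
  "beam_graph N E ND Cn Cm \<alpha>n \<beta>n \<alpha>m \<beta>m \<longleftrightarrow>
     finite N \<and> E \<subseteq> N \<times> N \<and>
     (\<forall>e\<in>E. fst e \<noteq> snd e \<and> (snd e, fst e) \<notin> E) \<and>
     (\<forall>x\<in>N. \<forall>y\<in>N. (x, y) \<in> (E \<union> E\<inverse>)\<^sup>*) \<and>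
     ND \<subseteq> N \<and> ND \<noteq> {} \<and>
     (\<forall>e\<in>E. coeff_ok (Cn e) \<alpha>n \<beta>n \<and> coeff_ok (Cm e) \<alpha>m \<beta>m \<and>
        (\<exists>j k. norm j = 1 \<and> norm k = 1 \<and> edge_dir e \<bullet> j = 0 \<and> edge_dir e \<bullet> k = 0 \<and> j \<bullet> k = 0
              \<and> cross3 (edge_dir e) j = k
              \<and> diag_in (Cn e) (edge_dir e) j k \<and> diag_in (Cm e) (edge_dir e) j k))"

end

(*
  On an edge of length h with direction i the force n is constant and the moment is
  m(x) = m0 - (x - h/2) (i \<times> n).  Testing the two constitutive equations with constants, and the second
  one with x - h/2 as well, determines the midpoint moment m0 and the force: with D, R the differences
  of the displacements and rotations at the end and the start node, and s the sum of the two rotations,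
    h Cm^{-1} m0 = -R   and   h S n = -D - (h/2) i \<times> s,
  where S = Cn^{-1} - (h^2/12) i \<times> Cm^{-1} (i \<times> .) is symmetric positive definite, uniformly for h <= 1.
  The edge contributes h (S n . n + Cm^{-1} m0 . m0) to A, which is comparable to
  |D + (h/2) i \<times> s|^2 / h + |R|^2 / h.  The rotations s are lower order: summed over the edges they
  are controlled by M(phi, phi), hence by L(phi, phi) / lambda_min.  Connectedness makes lambda_min
  positive.
*)
theory Submission
  imports Defs
begin

section \<open>Weak derivatives on an interval\<close>

text \<open>Dynkin argument: half-lines are an intersection-stable generator of the Borel sets, and
  the sets over which \<open>f\<close> integrates to zero are closed under complements (by
  \<open>total\<close>) and disjoint countable unions. A function whose integral vanishes over every
  Borel set is zero almost everywhere.\<close>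

lemma AE_zero_of_integral_atMost_zero:
  fixes f :: "real \<Rightarrow> 'a::euclidean_space"
  assumes f: "integrable lborel f" and total: "(LINT t|lborel. f t) = 0"
    and half: "\<And>x. (LINT t:{..x}|lborel. f t) = 0"
  shows "AE t in lborel. f t = 0"
proof -
  have int: "set_integrable lborel A f" if "A \<in> sets borel" for A
    using f that unfolding set_integrable_def by (intro integrable_mult_indicator) auto
  have borel: "sets borel = sigma_sets UNIV (range (atMost :: real \<Rightarrow> real set))"
    by (subst borel_eq_atMost) simp
  have "(LINT t:A|lborel. f t) = 0" if "A \<in> sets borel" for A
  proof -
    have "Int_stable (range (atMost :: real \<Rightarrow> real set))"
      unfolding Int_stable_def by (auto simp: image_iff)
    moreover have "range (atMost :: real \<Rightarrow> real set) \<subseteq> Pow UNIV" by simp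
    moreover have "A \<in> sigma_sets UNIV (range atMost)" using that borel by simp
    ultimately show ?thesis
    proof (induction A rule: sigma_sets_induct_disjoint)
      case (basic A)
      then show ?case using half by auto
    next
      case empty
      then show ?case by (simp add: set_lebesgue_integral_def)
    next
      case (compl A)
      then have A: "A \<in> sets borel" by (simp add: borel)
      have "(LINT t:UNIV|lborel. f t) = (LINT t:(UNIV - A) \<union> A|lborel. f t)" by simp
      also have "\<dots> = (LINT t:UNIV - A|lborel. f t) + (LINT t:A|lborel. f t)"
        using A by (intro set_integral_Un int) auto
      finally show ?case using compl total by (simp add: set_lebesgue_integral_def)
    next
      case (union A)
      then have A: "A i \<in> sets borel" for i by (auto simp: borel)
      have "(LINT t:(\<Union>i. A i)|lborel. f t) = (\<Sum>i. (LINT t:A i|lborel. f t))"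
        using A union(1) by (intro lebesgue_integral_countable_add int) (auto simp: disjoint_family_on_def)
      then show ?case using union by simp
    qed
  qed
  then show ?thesis
    using f by (intro sigma_finite_measure.density_zero[OF sigma_finite_lborel]) auto
qed

lemma H1d_integrable: "H1d h p p' \<Longrightarrow> set_integrable lborel {0..h} p'"
  by (simp add: H1d_def)

lemma H1d_integral:
  "H1d h p p' \<Longrightarrow> 0 \<le> x \<Longrightarrow> x \<le> h \<Longrightarrow> (LINT t:{0..x}|lborel. p' t) = p x - p 0"
  unfolding H1d_def by (metis add_diff_cancel_left' atLeastAtMost_iff)

text \<open>\<open>H1d\<close> determines the derivative only through its integrals over initial
  segments of the edge. These agree for \<open>f\<close> and \<open>g\<close>, which is exactly what
  the half-line criterion needs.\<close>

lemma weak_derivative_unique_AE: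
  assumes "0 \<le> h" "H1d h p f" "H1d h p g"
  shows "AE t in lborel. t \<in> {0..h} \<longrightarrow> f t = g t"
proof -
  have f: "set_integrable lborel {0..h} f" and g: "set_integrable lborel {0..h} g"
    using assms H1d_integrable by blast+
  \<comment> \<open>Extension by zero turns the statement on the edge into one on the whole
    line.\<close>
  define d where "d t = indicator {0..h} t *\<^sub>R (f t - g t)" for t
  have sub: "(LINT t:{0..x}|lborel. f t - g t) = 0" if "x \<in> {0..h}" for x
  proof -
    have "set_integrable lborel {0..x} f" "set_integrable lborel {0..x} g"
      using that by (auto intro: set_integrable_subset[OF f] set_integrable_subset[OF g])
    moreover have "(LINT t:{0..x}|lborel. f t) = (LINT t:{0..x}|lborel. g t)"
      using that by (simp add: H1d_integral[OF assms(2)] H1d_integral[OF assms(3)])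
    ultimately show ?thesis by (simp add: set_integral_diff)
  qed
  have "integrable lborel d"
    using set_integral_diff(1)[OF f g] unfolding d_def set_integrable_def .
  moreover have "(LINT t:{..x}|lborel. d t) = 0" for x
  proof (cases "0 \<le> x")
    case True
    \<comment> \<open>The support of \<open>d\<close> cuts the half-line down to an initial segment,
      which ends at \<open>h\<close> once \<open>x\<close> exceeds \<open>h\<close>.\<close>
    have "(LINT t:{..x}|lborel. d t) = (LINT t:{0..min x h}|lborel. f t - g t)"
      unfolding set_lebesgue_integral_def d_def
      by (intro Bochner_Integration.integral_cong) (auto simp: indicator_def)
    then show ?thesis using sub[of "min x h"] True assms by simp
  next
    case False
    then have "(\<lambda>t. indicator {..x} t *\<^sub>R d t) = (\<lambda>t. 0)" by (auto simp: d_def indicator_def)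
    then show ?thesis unfolding set_lebesgue_integral_def by simp
  qed
  moreover have "(LINT t|lborel. d t) = 0"
    using sub[of h] assms unfolding set_lebesgue_integral_def d_def by simp
  ultimately have "AE t in lborel. d t = 0" by (intro AE_zero_of_integral_atMost_zero)
  then show ?thesis by eventually_elim (auto simp: d_def)
qed

section \<open>Fundamental theorem, Fubini on a triangle, and integration by parts\<close>

lemma set_integral_FTC:
  fixes F :: "real \<Rightarrow> 'a::euclidean_space"
  assumes "a \<le> b" and "\<And>x. (F has_vector_derivative f x) (at x)" and "continuous_on UNIV f"
  shows "(LINT x:{a..b}|lborel. f x) = F b - F a"
  unfolding set_lebesgue_integral_def
  by (intro integral_FTC_atLeastAtMost assms(1) has_vector_derivative_at_within[OF assms(2)]
      continuous_on_subset[OF assms(3)]) simp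

lemma continuous_imp_L2:
  assumes "continuous_on UNIV f"
  shows "L2 h f"
proof -
  have "continuous_on {0..h} f" using assms continuous_on_subset by blast
  then have "set_integrable lborel {0..h} f" "set_integrable lborel {0..h} (\<lambda>x. (norm (f x))\<^sup>2)"
    by (auto intro!: borel_integrable_atLeastAtMost' continuous_intros)
  then show ?thesis
    by (auto simp: L2_def set_integrable_def set_borel_measurable_def)
qed

lemma H1d_of_has_vector_derivative:
  assumes "\<And>x. (p has_vector_derivative p' x) (at x)" and "continuous_on UNIV p'"
  shows "H1d h p p'"
  using continuous_imp_L2[OF assms(2)] borel_integrable_atLeastAtMost'[OF continuous_on_subset[OF assms(2)]]
  by (auto simp: H1d_def set_integral_FTC[OF _ assms])

text \<open>A continuous function is bounded on the compact interval, so a multiple of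
  \<open>f\<close> dominates the product.\<close>

lemma set_integrable_inner_continuous:
  fixes f g :: "real \<Rightarrow> 'a::euclidean_space"
  assumes f: "set_integrable lborel {a..b} f" and g: "continuous_on {a..b} g"
  shows "set_integrable lborel {a..b} (\<lambda>x. f x \<bullet> g x)"
proof -
  have "compact (g ` {a..b})" using g by (intro compact_continuous_image) auto
  then obtain B where B: "\<forall>x\<in>{a..b}. norm (g x) \<le> B"
    using compact_imp_bounded[of "g ` {a..b}"] by (auto simp: bounded_iff)
  have gm: "(\<lambda>x. indicator {a..b} x *\<^sub>R g x) \<in> borel_measurable lborel"
    using borel_integrable_atLeastAtMost'[OF g] by (simp add: set_integrable_def)
  have fm: "(\<lambda>x. indicator {a..b} x *\<^sub>R f x) \<in> borel_measurable lborel"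
    using f by (simp add: set_integrable_def)
  have "(\<lambda>x. indicator {a..b} x *\<^sub>R (f x \<bullet> g x)) =
      (\<lambda>x. (indicator {a..b} x *\<^sub>R f x) \<bullet> (indicator {a..b} x *\<^sub>R g x))"
    by (auto simp: indicator_def)
  then have m: "set_borel_measurable lborel {a..b} (\<lambda>x. f x \<bullet> g x)"
    unfolding set_borel_measurable_def using borel_measurable_inner[OF fm gm] by simp
  show ?thesis
  proof (rule set_integrable_bound[OF _ m])
    show "set_integrable lborel {a..b} (\<lambda>x. B *\<^sub>R f x)" using f by simp
    show "AE x in lborel. x \<in> {a..b} \<longrightarrow> norm (f x \<bullet> g x) \<le> norm (B *\<^sub>R f x)"
    proof (intro AE_I2 impI)
      fix x assume x: "x \<in> {a..b}"
      have "norm (f x \<bullet> g x) \<le> norm (f x) * norm (g x)" using Cauchy_Schwarz_ineq2 by simp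
      also have "\<dots> \<le> norm (f x) * B" using B x by (simp add: mult_left_mono)
      also have "\<dots> \<le> norm (B *\<^sub>R f x)" by (simp add: mult.commute mult_right_mono)
      finally show "norm (f x \<bullet> g x) \<le> norm (B *\<^sub>R f x)" .
    qed
  qed
qed

lemma set_integral_inner_left:
  fixes f :: "real \<Rightarrow> 'a::euclidean_space"
  assumes "set_integrable lborel A f"
  shows "(LINT x:A|lborel. f x \<bullet> c) = (LINT x:A|lborel. f x) \<bullet> c"
  using assms unfolding set_integrable_def set_lebesgue_integral_def
  by (simp flip: integral_inner_left)

lemma set_integral_inner_right:
  fixes f :: "real \<Rightarrow> 'a::euclidean_space"
  assumes "set_integrable lborel A f"
  shows "(LINT x:A|lborel. c \<bullet> f x) = c \<bullet> (LINT x:A|lborel. f x)"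
  using set_integral_inner_left[OF assms] by (simp add: inner_commute)

text \<open>Both sides integrate \<open>f t \<bullet> g x\<close> over the triangle
  \<open>t \<le> x\<close> of the square, in the two possible orders.\<close>

lemma set_integral_triangle_swap:
  fixes f g :: "real \<Rightarrow> 'a::euclidean_space"
  assumes f: "set_integrable lborel {0..h} f" and g: "set_integrable lborel {0..h} g"
  shows "(LINT x:{0..h}|lborel. (LINT t:{0..x}|lborel. f t) \<bullet> g x) =
    (LINT t:{0..h}|lborel. f t \<bullet> (LINT x:{t..h}|lborel. g x))"
proof -
  define F where "F t = indicator {0..h} t *\<^sub>R f t" for t
  define G where "G t = indicator {0..h} t *\<^sub>R g t" for t
  have F: "integrable lborel F" and G: "integrable lborel G"
    using f g unfolding F_def G_def set_integrable_def by simp_all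
  have [measurable]: "F \<in> borel_measurable borel" "G \<in> borel_measurable borel"
    using F G by auto
  \<comment> \<open>The kernel carries the indicator of the triangle; it is dominated by the product
    of the norms of \<open>F\<close> and \<open>G\<close>, so Fubini applies.\<close>
  define k where "k = (\<lambda>(t,x). (indicator {t. fst t \<le> snd t} (t,x) :: real) *\<^sub>R (F t \<bullet> G x))"
  have prod: "integrable (lborel \<Otimes>\<^sub>M lborel) (\<lambda>(t,x). norm (F t) * norm (G x))"
  proof (rule lborel_pair.Fubini_integrable)
    show "integrable lborel (\<lambda>t. LINT x|lborel. norm (case (t, x) of (t, x) \<Rightarrow> norm (F t) * norm (G x)))"
      using F G by simp
    show "AE t in lborel. integrable lborel (\<lambda>x. case (t, x) of (t, x) \<Rightarrow> norm (F t) * norm (G x))"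
      using F G by simp
  qed simp
  have k: "integrable (lborel \<Otimes>\<^sub>M lborel) k"
  proof (rule Bochner_Integration.integrable_bound[OF prod])
    have "{t::real\<times>real. fst t \<le> snd t} \<in> sets borel"
      by (intro borel_closed closed_Collect_le continuous_intros)
    moreover have "sets (lborel \<Otimes>\<^sub>M lborel) = sets (borel :: (real \<times> real) measure)"
      by (metis borel_prod sets_lborel sets_pair_measure_cong)
    ultimately have [measurable]: "{t::real\<times>real. fst t \<le> snd t} \<in> sets (lborel \<Otimes>\<^sub>M lborel)"
      by blast
    show "k \<in> borel_measurable (lborel \<Otimes>\<^sub>M lborel)"
      unfolding k_def case_prod_beta by measurable
    show "AE x in lborel \<Otimes>\<^sub>M lborel. norm (k x) \<le> norm (case x of (t, x) \<Rightarrow> norm (F t) * norm (G x))"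
      by (intro AE_I2) (auto simp: k_def indicator_def Cauchy_Schwarz_ineq2 split: prod.split)
  qed
  have "(LINT x|lborel. LINT t|lborel. k (t,x)) = (LINT t|lborel. LINT x|lborel. k (t,x))"
    using lborel_pair.Fubini_integral[of "\<lambda>t x. k (t,x)"] k by simp
  moreover have "(LINT t|lborel. k (t,x)) = indicator {0..h} x *\<^sub>R ((LINT t:{0..x}|lborel. f t) \<bullet> g x)" for x
  proof (cases "x \<in> {0..h}")
    case True
    have "set_integrable lborel {0..x} f" using True by (auto intro: set_integrable_subset[OF f])
    then have "(LINT t:{0..x}|lborel. f t) \<bullet> g x = (LINT t:{0..x}|lborel. f t \<bullet> g x)"
      by (simp add: set_integral_inner_left)
    also have "\<dots> = (LINT t|lborel. k (t,x))"
      unfolding set_lebesgue_integral_def using True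
      by (intro Bochner_Integration.integral_cong) (auto simp: k_def F_def G_def indicator_def)
    finally show ?thesis using True by simp
  qed (simp add: k_def G_def)
  moreover have "(LINT x|lborel. k (t,x)) = indicator {0..h} t *\<^sub>R (f t \<bullet> (LINT x:{t..h}|lborel. g x))" for t
  proof (cases "t \<in> {0..h}")
    case True
    have "set_integrable lborel {t..h} g" using True by (auto intro: set_integrable_subset[OF g])
    then have "f t \<bullet> (LINT x:{t..h}|lborel. g x) = (LINT x:{t..h}|lborel. f t \<bullet> g x)"
      by (simp add: set_integral_inner_right)
    also have "\<dots> = (LINT x|lborel. k (t,x))"
      unfolding set_lebesgue_integral_def using True
      by (intro Bochner_Integration.integral_cong) (auto simp: k_def F_def G_def indicator_def)
    finally show ?thesis using True by simp
  qed (simp add: k_def F_def)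
  ultimately show ?thesis unfolding set_lebesgue_integral_def by simp
qed

lemma H1d_continuous_on:
  assumes p: "H1d h p p'"
  shows "continuous_on {0..h} p"
proof -
  note p'i = H1d_integrable[OF p]
  have "continuous_on {0..h} (\<lambda>x. p 0 + integral {0..x} p')"
    using set_borel_integral_eq_integral(1)[OF p'i]
    by (intro continuous_intros indefinite_integral_continuous_1)
  moreover have "p 0 + integral {0..x} p' = p x" if "x \<in> {0..h}" for x
  proof -
    have x: "set_integrable lborel {0..x} p'" using that by (auto intro: set_integrable_subset[OF p'i])
    show ?thesis using set_borel_integral_eq_integral(2)[OF x] H1d_integral[OF p, of x] that
      by simp
  qed
  ultimately show ?thesis by (simp cong: continuous_on_cong_simp)
qed

text \<open>Since \<open>p\<close> is only weakly differentiable, no product rule is applied to it.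
  Instead \<open>p\<close> is written as \<open>p 0\<close> plus the integral of \<open>p'\<close>,
  and the order of integration is exchanged.\<close>

lemma ip_integration_by_parts:
  assumes h: "0 \<le> h" and p: "H1d h p p'"
    and U: "\<And>x. (U has_vector_derivative U' x) (at x)" and U': "continuous_on UNIV U'"
  shows "ip h U p' = U h \<bullet> p h - U 0 \<bullet> p 0 - ip h U' p"
proof -
  note p'i = H1d_integrable[OF p] and pI = H1d_integral[OF p]
  have U'i: "set_integrable lborel {a..b} U'" for a b
    by (intro borel_integrable_atLeastAtMost' continuous_on_subset[OF U']) simp
  have Uc: "continuous_on {0..h} U"
    using has_vector_derivative_continuous[OF U] by (auto intro: continuous_at_imp_continuous_on)
  have Ui: "set_integrable lborel {0..h} (\<lambda>t. p' t \<bullet> U t)"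
    by (rule set_integrable_inner_continuous[OF p'i Uc])
  have Uci: "set_integrable lborel {0..h} (\<lambda>t. p' t \<bullet> U h)"
    by (rule set_integrable_inner_continuous[OF p'i]) simp
  \<comment> \<open>After the exchange the inner integral of \<open>U'\<close> over
    \<open>{t..h}\<close> is \<open>U h - U t\<close>.\<close>
  have tri: "(LINT x:{0..h}|lborel. (LINT t:{0..x}|lborel. p' t) \<bullet> U' x) =
      (LINT t:{0..h}|lborel. p' t \<bullet> U h) - (LINT t:{0..h}|lborel. p' t \<bullet> U t)"
  proof -
    have "(LINT x:{0..h}|lborel. (LINT t:{0..x}|lborel. p' t) \<bullet> U' x) =
        (LINT t:{0..h}|lborel. p' t \<bullet> (LINT x:{t..h}|lborel. U' x))"
      by (rule set_integral_triangle_swap[OF p'i U'i])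
    also have "\<dots> = (LINT t:{0..h}|lborel. p' t \<bullet> U h - p' t \<bullet> U t)"
      by (intro set_lebesgue_integral_cong) (auto simp: set_integral_FTC[OF _ U U'] inner_diff_right)
    finally show ?thesis using Ui Uci by (simp add: set_integral_diff)
  qed
  have "continuous_on {0..h} (\<lambda>x. LINT t:{0..x}|lborel. p' t)"
    by (rule continuous_on_cong[THEN iffD2, OF refl _ continuous_on_diff[OF H1d_continuous_on[OF p] continuous_on_const]])
      (simp add: pI)
  then have triI: "set_integrable lborel {0..h} (\<lambda>x. (LINT t:{0..x}|lborel. p' t) \<bullet> U' x)"
    by (intro borel_integrable_atLeastAtMost' continuous_on_inner) (auto intro: continuous_on_subset[OF U'])
  have "ip h U' p = (LINT x:{0..h}|lborel. p 0 \<bullet> U' x + (LINT t:{0..x}|lborel. p' t) \<bullet> U' x)"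
    unfolding ip_def
    by (intro set_lebesgue_integral_cong) (auto simp: pI inner_diff_left inner_commute[of "U' _"])
  also have "\<dots> = p 0 \<bullet> (LINT x:{0..h}|lborel. U' x) + (LINT x:{0..h}|lborel. (LINT t:{0..x}|lborel. p' t) \<bullet> U' x)"
  proof -
    have "set_integrable lborel {0..h} (\<lambda>x. p 0 \<bullet> U' x)"
      by (intro borel_integrable_atLeastAtMost' continuous_intros) (auto intro: continuous_on_subset[OF U'])
    then show ?thesis using triI U'i by (simp add: set_integral_add set_integral_inner_right)
  qed
  also have "\<dots> = p 0 \<bullet> (U h - U 0) + (p h - p 0) \<bullet> U h - ip h U p'"
    using tri h p'i by (simp add: pI set_integral_FTC[OF _ U U'] set_integral_inner_right ip_def inner_commute)
  finally show ?thesis by (simp add: inner_diff_left inner_diff_right inner_commute)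
qed

section \<open>The local solver\<close>

lemma set_integral_affine_mean:
  fixes a b :: real
  assumes "0 \<le> h"
  shows "(LINT x:{0..h}|lborel. a - (x - h/2) * b) = h * a"
proof -
  have "(LINT x:{0..h}|lborel. a - (x - h/2) * b) = (\<lambda>x. a * x - (x\<^sup>2/2 - h*x/2) * b) h - (\<lambda>x. a * x - (x\<^sup>2/2 - h*x/2) * b) 0"
    using assms by (intro set_integral_FTC) (auto intro!: derivative_eq_intros continuous_intros
        simp flip: has_real_derivative_iff_has_vector_derivative)
  then show ?thesis by (simp add: power2_eq_square)
qed

text \<open>The constant part drops out because \<open>x - h/2\<close> has mean zero. The integral
  of its square, \<open>h^3/12\<close>, is the origin of the weight \<open>h\<^sup>2/12\<close> in
  \<open>compliance\<close>.\<close>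

lemma set_integral_affine_moment:
  fixes a b :: real
  assumes "0 \<le> h"
  shows "(LINT x:{0..h}|lborel. (a - (x - h/2) * b) * (x - h/2)) = - (h^3/12) * b"
proof -
  have "(LINT x:{0..h}|lborel. (a - (x - h/2) * b) * (x - h/2)) =
      (\<lambda>x. a * (x\<^sup>2/2 - h*x/2) - b * (x^3/3 - h*x\<^sup>2/2 + h\<^sup>2*x/4)) h -
      (\<lambda>x. a * (x\<^sup>2/2 - h*x/2) - b * (x^3/3 - h*x\<^sup>2/2 + h\<^sup>2*x/4)) 0"
    using assms by (intro set_integral_FTC) (auto intro!: derivative_eq_intros continuous_intros
        simp: field_simps power2_eq_square simp flip: has_real_derivative_iff_has_vector_derivative)
  then show ?thesis by (simp add: power2_eq_square power3_eq_cube field_simps)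
qed

text \<open>The operator \<open>S\<close> that remains after eliminating the moment from the local problem.\<close>

definition compliance :: "real \<Rightarrow> vec3 \<Rightarrow> real^3^3 \<Rightarrow> real^3^3 \<Rightarrow> vec3 \<Rightarrow> vec3" where
  "compliance h i P Q x = P *v x - (h\<^sup>2 / 12) *\<^sub>R cross3 i (Q *v cross3 i x)"

lemma L2_indicator:
  assumes "x \<le> h"
  shows "L2 h (\<lambda>t. indicator {0..x} t *\<^sub>R c)"
proof -
  have eq: "(\<lambda>t. indicator {0..h} t *\<^sub>R indicator {0..x} t *\<^sub>R c) = (\<lambda>t. indicator {0..x} t *\<^sub>R c)"
    and eq2: "(\<lambda>t. indicator {0..h} t *\<^sub>R (norm (indicator {0..x} t *\<^sub>R c))\<^sup>2) =
      (\<lambda>t. indicator {0..x} t *\<^sub>R (norm c)\<^sup>2)"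
    using assms by (auto simp: indicator_def)
  have "integrable lborel (\<lambda>t. indicator {0..x} t *\<^sub>R c)"
    "integrable lborel (\<lambda>t. indicator {0..x} t *\<^sub>R (norm c)\<^sup>2)"
    using borel_integrable_atLeastAtMost'[of 0 x "\<lambda>_. c"]
      borel_integrable_atLeastAtMost'[of 0 x "\<lambda>_. (norm c)\<^sup>2"]
    unfolding set_integrable_def by simp_all
  then show ?thesis
    unfolding L2_def set_borel_measurable_def set_integrable_def eq eq2
    using borel_measurable_integrable by blast
qed

lemma ip_indicator:
  assumes "x \<le> h"
  shows "ip h f (\<lambda>t. indicator {0..x} t *\<^sub>R c) = (LINT t:{0..x}|lborel. f t \<bullet> c)"
  unfolding ip_def set_lebesgue_integral_def using assms
  by (intro Bochner_Integration.integral_cong) (auto simp: indicator_def)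

lemma cross3_inner_cyclic: "cross3 i x \<bullet> y = - (x \<bullet> cross3 i y)"
  by (simp add: cross3_simps)

text \<open>Testing the two equilibrium equations with the indicator of an initial segment gives
  pointwise information without any almost-everywhere argument.\<close>

lemma local_sol_imp_affine:
  assumes h: "0 \<le> h" and sol: "local_sol h i Cn Cm ua ub ra rb u r n m" and x: "x \<in> {0..h}"
  shows "n x = n 0" and "m x = m 0 - x *\<^sub>R cross3 i (n 0)"
proof -
  obtain n' m' where n': "H1d h n n'" and m': "H1d h m m'"
    using sol unfolding local_sol_def H1_def by blast
  have n0: "ip h n' v = 0" if "L2 h v" for v
    using sol n' that unfolding local_sol_def by blast
  have m0: "ip h (\<lambda>x. cross3 i (n x)) v + ip h m' v = 0" if "L2 h v" for v
    using sol m' that unfolding local_sol_def by blast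
  have int: "(LINT t:{0..y}|lborel. g' t \<bullet> c) = (g y - g 0) \<bullet> c"
    if "H1d h g g'" "y \<in> {0..h}" for g g' y c
  proof -
    have "set_integrable lborel {0..y} g'"
      using that(2) by (auto intro: set_integrable_subset[OF H1d_integrable[OF that(1)]])
    then show ?thesis using H1d_integral[OF that(1)] that(2) by (simp add: set_integral_inner_left)
  qed
  define a where "a = n 0"
  \<comment> \<open>The test vector is the increment \<open>n y - n 0\<close> itself, so the tested
    equation says that its squared norm is zero.\<close>
  have nc: "n y = a" if "y \<in> {0..h}" for y
    using n0[OF L2_indicator, of y "n y - n 0"] int[OF n' that, of "n y - n 0"] that
    by (simp add: ip_indicator a_def)
  show "n x = n 0" using nc[OF x] by (simp add: a_def)
  define k where "k = cross3 i a"
  \<comment> \<open>\<open>c\<close> is the defect in the claimed formula for \<open>m x\<close>.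
    Used as its own test vector it yields \<open>c \<bullet> c = 0\<close>.\<close>
  define c where "c = m x - m 0 + x *\<^sub>R k"
  have "(LINT t:{0..x}|lborel. cross3 i (n t) \<bullet> c) = (LINT t:{0..x}|lborel. k \<bullet> c)"
    using x nc by (intro set_lebesgue_integral_cong) (auto simp: k_def)
  also have "\<dots> = x * (k \<bullet> c)" using x by (simp add: set_integral_const)
  finally have "x * (k \<bullet> c) + (m x - m 0) \<bullet> c = 0"
    using m0[OF L2_indicator, of x c] int[OF m' x, of c] x by (simp add: ip_indicator)
  then have "c \<bullet> c = 0" unfolding c_def by (simp add: inner_add_left)
  then have "c = 0" by simp
  then show "m x = m 0 - x *\<^sub>R cross3 i (n 0)" by (simp add: c_def k_def a_def algebra_simps)
qed

text \<open>Constant test functions remove \<open>u\<close> from the force equation and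
  \<open>r\<close> from the moment equation. The rotation then survives only through its mean in the
  force equation, and the moment equation supplies that mean when tested with
  \<open>x - h/2\<close>.\<close>

lemma local_sol_equations:
  assumes h: "0 \<le> h" and sol: "local_sol h i Cn Cm ua ub ra rb u r n m"
    and nx: "\<And>x. x \<in> {0..h} \<Longrightarrow> n x = n0"
    and mx: "\<And>x. x \<in> {0..h} \<Longrightarrow> m x = m0 - (x - h/2) *\<^sub>R cross3 i n0"
  shows "h *\<^sub>R (matrix_inv Cm *v m0) = ra - rb"
    and "h *\<^sub>R compliance h i (matrix_inv Cn) (matrix_inv Cm) n0 = ua - ub - (h/2) *\<^sub>R cross3 i (ra + rb)"
proof -
  define P where "P = matrix_inv Cn"
  define Q where "Q = matrix_inv Cm"
  define k where "k = cross3 i n0"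
  have force: "- ip h (\<lambda>x. P *v n x) p + ip h u p' - ip h (\<lambda>x. cross3 i (r x)) p = ub \<bullet> p h - ua \<bullet> p 0"
    if "H1d h p p'" for p p' using sol that unfolding local_sol_def P_def by blast
  have moment: "- ip h (\<lambda>x. Q *v m x) q + ip h r q' = rb \<bullet> q h - ra \<bullet> q 0"
    if "H1d h q q'" for q q' using sol that unfolding local_sol_def Q_def by blast
  have const: "H1d h (\<lambda>_. c) (\<lambda>_. 0)" for c :: vec3
    by (intro H1d_of_has_vector_derivative) auto
  have Qm: "(Q *v m x) \<bullet> c = (Q *v m0) \<bullet> c - (x - h/2) * ((Q *v k) \<bullet> c)" if "x \<in> {0..h}" for x c
    using mx[OF that] by (simp add: k_def matrix_vector_mult_diff_distrib matrix_vector_mult_scaleR inner_diff_left)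
  \<comment> \<open>An identity of vectors is obtained by pairing with an arbitrary constant
    \<open>c\<close>; the linear part of \<open>m\<close> integrates to zero against it.\<close>
  have "(ra - rb) \<bullet> c = (h *\<^sub>R (Q *v m0)) \<bullet> c" for c
  proof -
    have "ip h (\<lambda>x. Q *v m x) (\<lambda>_. c) = h * ((Q *v m0) \<bullet> c)"
      unfolding ip_def set_integral_affine_mean[OF h, of "(Q *v m0) \<bullet> c" "(Q *v k) \<bullet> c", symmetric]
      by (intro set_lebesgue_integral_cong) (auto simp: Qm)
    moreover have "ip h r (\<lambda>_. 0) = 0" by (simp add: ip_def)
    ultimately show ?thesis using moment[OF const, of c] by (simp add: inner_diff_left)
  qed
  then show "h *\<^sub>R (matrix_inv Cm *v m0) = ra - rb" unfolding Q_def using vector_eq_rdot by metis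
  \<comment> \<open>The test function \<open>(x - h/2) *\<^sub>R d\<close> has derivative
    \<open>d\<close>, so the pairing of \<open>r\<close> with \<open>q'\<close> is the integral of
    \<open>r \<bullet> d\<close>. Its end values \<open>d\<close> times \<open>h/2\<close> and
    \<open>-h/2\<close> produce the sum of the nodal rotations.\<close>
  have rd: "ip h r (\<lambda>_. d) = (h/2) * ((ra + rb) \<bullet> d) - (h^3/12) * ((Q *v k) \<bullet> d)" for d
  proof -
    have "H1d h (\<lambda>x. (x - h/2) *\<^sub>R d) (\<lambda>_. d)"
      by (intro H1d_of_has_vector_derivative) (auto intro!: derivative_eq_intros)
    note moment[OF this]
    moreover have "ip h (\<lambda>x. Q *v m x) (\<lambda>x. (x - h/2) *\<^sub>R d) = - (h^3/12) * ((Q *v k) \<bullet> d)"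
      unfolding ip_def set_integral_affine_moment[OF h, of "(Q *v m0) \<bullet> d" "(Q *v k) \<bullet> d", symmetric]
      by (intro set_lebesgue_integral_cong) (auto simp: Qm)
    ultimately show ?thesis by (simp add: inner_add_left algebra_simps)
  qed
  have "(ua - ub - (h/2) *\<^sub>R cross3 i (ra + rb)) \<bullet> c = (h *\<^sub>R compliance h i P Q n0) \<bullet> c" for c
  proof -
    have "ip h (\<lambda>x. P *v n x) (\<lambda>_. c) = h * ((P *v n0) \<bullet> c)"
      unfolding ip_def set_integral_affine_mean[OF h, of "(P *v n0) \<bullet> c" 0, symmetric]
      by (intro set_lebesgue_integral_cong) (auto simp: nx)
    moreover have "ip h u (\<lambda>_. 0) = 0" by (simp add: ip_def)
    moreover have "ip h (\<lambda>x. cross3 i (r x)) (\<lambda>_. c) = ip h r (\<lambda>_. - cross3 i c)"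
      by (simp add: ip_def cross3_inner_cyclic)
    moreover have "y \<bullet> cross3 i c = - (cross3 i y \<bullet> c)" for y by (simp add: cross3_inner_cyclic)
    ultimately show ?thesis
      using force[OF const, of c] rd[of "- cross3 i c"]
      by (simp add: compliance_def k_def inner_diff_left right_diff_distrib power2_eq_square power3_eq_cube)
  qed
  then show "h *\<^sub>R compliance h i (matrix_inv Cn) (matrix_inv Cm) n0 = ua - ub - (h/2) *\<^sub>R cross3 i (ra + rb)"
    unfolding P_def Q_def using vector_eq_rdot by metis
qed

lemma weak_derivative_inner_AE:
  assumes "0 \<le> h" "H1d h p f" "H1d h p g"
  shows "AE t in lborel. indicator {0..h} t *\<^sub>R (f t \<bullet> w t) = indicator {0..h} t *\<^sub>R (g t \<bullet> w t)"
  using weak_derivative_unique_AE[OF assms] by eventually_elim (auto simp: indicator_def)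

text \<open>\<open>local_sol\<close> states equilibrium for every weak derivative of
  \<open>n\<close> and \<open>m\<close>. This transfers a check made with one classical derivative
  to all the others.\<close>

lemma ip_weak_derivative_cong:
  assumes h: "0 \<le> h" and f: "H1d h p f" and g: "H1d h p g" and w: "L2 h w"
  shows "ip h f w = ip h g w"
proof -
  have meas: "(\<lambda>t. indicator {0..h} t *\<^sub>R (f t \<bullet> w t)) \<in> borel_measurable lborel" if "H1d h p f" for f
  proof -
    have "(\<lambda>t. indicator {0..h} t *\<^sub>R (f t \<bullet> w t)) =
        (\<lambda>t. (indicator {0..h} t *\<^sub>R f t) \<bullet> (indicator {0..h} t *\<^sub>R w t))"
      by (auto simp: indicator_def)
    then show ?thesis
      using that w borel_measurable_inner[of "\<lambda>t. indicator {0..h} t *\<^sub>R f t" lborel "\<lambda>t. indicator {0..h} t *\<^sub>R w t"]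
      by (simp add: H1d_def L2_def set_borel_measurable_def)
  qed
  show ?thesis
    unfolding ip_def set_lebesgue_integral_def
    by (rule integral_cong_AE[OF meas[OF f] meas[OF g] weak_derivative_inner_AE[OF h f g]])
qed

text \<open>The solution is an explicit polynomial: integrate \<open>r' = - Q m\<close> and
  \<open>u' = - P n0 - i \<times> r\<close> from the nodal values at the start node. The two assumed
  equations are precisely the conditions for hitting \<open>rb\<close> and \<open>ub\<close> at the
  end node.\<close>

lemma local_sol_exists:
  assumes h: "0 \<le> h"
    and eqm: "h *\<^sub>R (matrix_inv Cm *v m0) = ra - rb"
    and eqn: "h *\<^sub>R compliance h i (matrix_inv Cn) (matrix_inv Cm) n0 = ua - ub - (h/2) *\<^sub>R cross3 i (ra + rb)"
  shows "\<exists>u r. local_sol h i Cn Cm ua ub ra rb u r (\<lambda>_. n0) (\<lambda>x. m0 - (x - h/2) *\<^sub>R cross3 i n0)"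
proof -
  define P where "P = matrix_inv Cn"
  define Q where "Q = matrix_inv Cm"
  define k where "k = cross3 i n0"
  define m where "m x = m0 - (x - h/2) *\<^sub>R k" for x
  define r where "r x = ra - x *\<^sub>R (Q *v m0) + (x\<^sup>2/2 - h*x/2) *\<^sub>R (Q *v k)" for x
  \<comment> \<open>\<open>R\<close> is the antiderivative of \<open>r\<close> vanishing at the
    start node; it is needed to integrate the rotation term in \<open>u'\<close>.\<close>
  define R where "R x = x *\<^sub>R ra - (x\<^sup>2/2) *\<^sub>R (Q *v m0) + (x^3/6 - h*x\<^sup>2/4) *\<^sub>R (Q *v k)" for x
  define u where "u x = ua - x *\<^sub>R (P *v n0) - cross3 i (R x)" for x
  have Qm: "Q *v m x = Q *v m0 - (x - h/2) *\<^sub>R (Q *v k)" for x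
    by (simp add: m_def matrix_vector_mult_diff_distrib matrix_vector_mult_scaleR)
  have m': "(m has_vector_derivative - k) (at x)" for x
    unfolding m_def by (auto intro!: derivative_eq_intros)
  have r': "(r has_vector_derivative - (Q *v m x)) (at x)" for x
    unfolding r_def Qm by (auto intro!: derivative_eq_intros simp: algebra_simps)
  have R': "(R has_vector_derivative r x) (at x)" for x
    unfolding r_def R_def by (auto intro!: derivative_eq_intros simp: field_simps)
  have u': "(u has_vector_derivative - (P *v n0) - cross3 i (r x)) (at x)" for x
    unfolding u_def
    using bounded_linear.has_vector_derivative[OF bilinear_cross[THEN bilinear_conv_bounded_bilinear[THEN iffD1], THEN bounded_bilinear.bounded_linear_right] R', of i x]
    by (auto intro!: derivative_eq_intros)
  have cont: "continuous_on UNIV m" "continuous_on UNIV r" "continuous_on UNIV u"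
    using has_vector_derivative_continuous[OF m'] has_vector_derivative_continuous[OF r']
      has_vector_derivative_continuous[OF u'] by (auto simp: continuous_on_eq_continuous_at)
  have cu': "continuous_on UNIV (\<lambda>x. - (P *v n0) - cross3 i (r x))"
    using cont by (intro continuous_intros continuous_on_cross)
  have cr': "continuous_on UNIV (\<lambda>x. - (Q *v m x))"
    using cont unfolding Qm by (intro continuous_intros)
  have r_h: "r h = rb" using eqm by (simp add: r_def Q_def power2_eq_square)
  \<comment> \<open>The total rotation over the edge is its trapezoidal value minus a cubic
    correction, once \<open>eqm\<close> has eliminated \<open>m0\<close>. The correction is the one
    contained in \<open>compliance\<close>.\<close>
  have R_h: "R h = (h/2) *\<^sub>R (ra + rb) - (h^3/12) *\<^sub>R (Q *v k)"
  proof -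
    have "R h = h *\<^sub>R ra - (h/2) *\<^sub>R (h *\<^sub>R (Q *v m0)) - (h^3/12) *\<^sub>R (Q *v k)"
    proof -
      have "h^3/6 - h*h\<^sup>2/4 = - (h^3/12)" by (simp add: power2_eq_square power3_eq_cube)
      then show ?thesis by (simp add: R_def power2_eq_square)
    qed
    also have "h *\<^sub>R (Q *v m0) = ra - rb" using eqm by (simp add: Q_def)
    finally have "R h = h *\<^sub>R ra - (h/2) *\<^sub>R (ra - rb) - (h^3/12) *\<^sub>R (Q *v k)" .
    moreover have "h *\<^sub>R ra = (h/2) *\<^sub>R ra + (h/2) *\<^sub>R ra" by (simp flip: scaleR_add_left)
    ultimately show ?thesis by (simp add: scaleR_diff_right scaleR_add_right)
  qed
  have u_h: "u h = ub"
  proof -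
    have "h *\<^sub>R (P *v n0) = ua - ub - (h/2) *\<^sub>R cross3 i (ra + rb) + (h^3/12) *\<^sub>R cross3 i (Q *v k)"
      using eqn by (simp add: compliance_def P_def Q_def k_def scaleR_diff_right power2_eq_square power3_eq_cube algebra_simps)
    then show ?thesis
      by (simp add: u_def R_h Cross3.right_diff_distrib cross_mult_right)
  qed
  have ends: "r 0 = ra" "u 0 = ua" by (simp_all add: r_def u_def R_def)
  have n1: "H1d h (\<lambda>_. n0) (\<lambda>_. 0)" and m1: "H1d h m (\<lambda>_. - k)"
    by (intro H1d_of_has_vector_derivative m' continuous_intros has_vector_derivative_const)+
  have "local_sol h i Cn Cm ua ub ra rb u r (\<lambda>_. n0) m"
    unfolding local_sol_def P_def[symmetric] Q_def[symmetric] k_def[symmetric]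
  proof (intro conjI allI impI)
    show "L2 h u" "L2 h r" using cont continuous_imp_L2 by auto
    show "H1 h (\<lambda>_. n0)" "H1 h m" using n1 m1 by (auto simp: H1_def)
  next
    \<comment> \<open>The weak equations are the pointwise equations for \<open>u'\<close> and
      \<open>r'\<close> integrated by parts, the boundary terms being the nodal data.\<close>
    fix p p' assume p: "H1d h p p'"
    note pc = H1d_continuous_on[OF p]
    have "ip h (\<lambda>x. - (P *v n0) - cross3 i (r x)) p = - ip h (\<lambda>x. P *v n0) p - ip h (\<lambda>x. cross3 i (r x)) p"
    proof -
      have i1: "set_integrable lborel {0..h} (\<lambda>x. (P *v n0) \<bullet> p x)"
        using pc by (intro borel_integrable_atLeastAtMost' continuous_intros)
      have i2: "set_integrable lborel {0..h} (\<lambda>x. cross3 i (r x) \<bullet> p x)"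
        using pc continuous_on_subset[OF cont(2)]
        by (intro borel_integrable_atLeastAtMost' continuous_intros continuous_on_cross) auto
      have "ip h (\<lambda>x. - (P *v n0) - cross3 i (r x)) p =
          (LINT x:{0..h}|lborel. - ((P *v n0) \<bullet> p x + cross3 i (r x) \<bullet> p x))"
        by (simp add: ip_def inner_diff_left)
      also have "\<dots> = - (LINT x:{0..h}|lborel. (P *v n0) \<bullet> p x + cross3 i (r x) \<bullet> p x)"
        by (rule set_integral_uminus[OF set_integral_add(1)[OF i1 i2]])
      finally show ?thesis unfolding set_integral_add(2)[OF i1 i2] by (simp add: ip_def)
    qed
    then show "- ip h (\<lambda>x. P *v n0) p + ip h u p' - ip h (\<lambda>x. cross3 i (r x)) p = ub \<bullet> p h - ua \<bullet> p 0"
      using ip_integration_by_parts[OF h p u' cu'] u_h ends by simp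
  next
    fix q q' assume q: "H1d h q q'"
    have "ip h (\<lambda>x. - (Q *v m x)) q = - ip h (\<lambda>x. Q *v m x) q"
      by (simp add: ip_def set_lebesgue_integral_def)
    then show "- ip h (\<lambda>x. Q *v m x) q + ip h r q' = rb \<bullet> q h - ra \<bullet> q 0"
      using ip_integration_by_parts[OF h q r' cr'] r_h ends by simp
  next
    fix n' v assume "H1d h (\<lambda>_. n0) n'" "L2 h v"
    from ip_weak_derivative_cong[OF h this(1) n1 this(2)]
    show "ip h n' v = 0" by (simp add: ip_def)
  next
    fix m' w assume "H1d h m m'" "L2 h w"
    from ip_weak_derivative_cong[OF h this(1) m1 this(2)]
    show "ip h (\<lambda>x. k) w + ip h m' w = 0" by (simp add: ip_def set_lebesgue_integral_def)
  qed
  then show ?thesis unfolding m_def k_def by blast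
qed

section \<open>Energy of a single edge\<close>

lemma coeff_ok_le:
  assumes "coeff_ok C \<alpha> \<beta>"
  shows "\<alpha> \<le> \<beta>"
proof -
  have "\<alpha> * (norm (axis 1 1 :: vec3))\<^sup>2 \<le> \<beta> * (norm (axis 1 1 :: vec3))\<^sup>2"
    using assms unfolding coeff_ok_def by (meson order_trans)
  then show ?thesis by (simp add: norm_axis_1)
qed

lemma coeff_ok_symmetric:
  assumes "coeff_ok C \<alpha> \<beta>"
  shows "(C *v x) \<bullet> y = x \<bullet> (C *v y)"
  using assms dot_lmul_matrix[of x C y] transpose_matrix_vector[of C x] by (simp add: coeff_ok_def)

text \<open>Coercivity makes the kernel trivial, which for a square matrix means
  invertibility.\<close>

lemma coeff_ok_inverse:
  assumes C: "coeff_ok C \<alpha> \<beta>" and "0 < \<alpha>"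
  shows "C *v (matrix_inv C *v x) = x" and "matrix_inv C *v (C *v x) = x"
proof -
  have "x = 0" if "C *v x = 0" for x
  proof -
    have "\<alpha> * (norm x)\<^sup>2 \<le> (C *v x) \<bullet> x" using C by (simp add: coeff_ok_def)
    then show ?thesis using that \<open>0 < \<alpha>\<close> by (simp add: mult_le_0_iff)
  qed
  then have "invertible C"
    by (simp add: invertible_left_inverse matrix_left_invertible_ker)
  then have inv: "C ** matrix_inv C = mat 1" "matrix_inv C ** C = mat 1"
    unfolding invertible_def matrix_inv_def by (metis (mono_tags, lifting) someI_ex)+
  show "C *v (matrix_inv C *v x) = x" "matrix_inv C *v (C *v x) = x"
    by (simp_all add: matrix_vector_mul_assoc inv)
qed

text \<open>The operator inequality \<open>f^2 \<le> b f\<close> for a symmetric \<open>f\<close>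
  between \<open>0\<close> and \<open>b\<close>. It is the nonnegativity of the form at
  \<open>x - (1/b) *\<^sub>R f x\<close>, with the quadratic term in \<open>f x\<close> estimated by
  \<open>bd\<close>.\<close>

lemma norm_square_le_form:
  fixes f :: "'a::real_inner \<Rightarrow> 'a"
  assumes "linear f" and sym: "\<And>x y. f x \<bullet> y = x \<bullet> f y"
    and pos: "\<And>x. 0 \<le> f x \<bullet> x" and bd: "\<And>x. f x \<bullet> x \<le> b * (norm x)\<^sup>2" and b: "0 < b"
  shows "(norm (f x))\<^sup>2 \<le> b * (f x \<bullet> x)"
proof -
  let ?z = "x - (1/b) *\<^sub>R f x"
  have "0 \<le> f ?z \<bullet> ?z" by (rule pos)
  also have "f ?z = f x - (1/b) *\<^sub>R f (f x)"
    using \<open>linear f\<close> by (simp add: linear_diff linear_scale)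
  also have "\<dots> \<bullet> ?z = f x \<bullet> x - (2/b) * (norm (f x))\<^sup>2 + (1/b\<^sup>2) * (f (f x) \<bullet> f x)"
    using sym[of "f x" x] unfolding power2_norm_eq_inner
    by (simp add: inner_diff_left inner_diff_right power2_eq_square algebra_simps)
  also have "\<dots> \<le> f x \<bullet> x - (2/b) * (norm (f x))\<^sup>2 + (1/b\<^sup>2) * (b * (norm (f x))\<^sup>2)"
    using bd[of "f x"] by (intro add_left_mono mult_left_mono) auto
  also have "\<dots> = f x \<bullet> x - (1/b) * (norm (f x))\<^sup>2"
    using b by (simp add: field_simps power2_eq_square)
  finally show ?thesis using b by (simp add: field_simps)
qed

lemma inverse_coeff_symmetric:
  assumes C: "coeff_ok C \<alpha> \<beta>" "0 < \<alpha>"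
  shows "(matrix_inv C *v x) \<bullet> y = x \<bullet> (matrix_inv C *v y)"
  using coeff_ok_symmetric[OF C(1), of "matrix_inv C *v x" "matrix_inv C *v y"]
  by (simp add: coeff_ok_inverse[OF C])

text \<open>All four bounds are statements about \<open>C\<close> at
  \<open>y = matrix_inv C *v x\<close>. The first two are its form bounds, the third follows by
  Cauchy-Schwarz, and the fourth is \<open>norm_square_le_form\<close> for \<open>C\<close>.\<close>

lemma inverse_coeff_bounds:
  assumes C: "coeff_ok C \<alpha> \<beta>" "0 < \<alpha>"
  shows "\<alpha> * (norm (matrix_inv C *v x))\<^sup>2 \<le> (matrix_inv C *v x) \<bullet> x"
    and "(matrix_inv C *v x) \<bullet> x \<le> \<beta> * (norm (matrix_inv C *v x))\<^sup>2"
    and "(matrix_inv C *v x) \<bullet> x \<le> (1/\<alpha>) * (norm x)\<^sup>2"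
    and "(norm x)\<^sup>2 \<le> \<beta> * ((matrix_inv C *v x) \<bullet> x)"
proof -
  let ?y = "matrix_inv C *v x"
  have b: "\<alpha> * (norm y)\<^sup>2 \<le> (C *v y) \<bullet> y" "(C *v y) \<bullet> y \<le> \<beta> * (norm y)\<^sup>2" for y
    using C(1) by (auto simp: coeff_ok_def)
  have Cy: "C *v ?y = x" by (rule coeff_ok_inverse[OF C])
  show lo: "\<alpha> * (norm ?y)\<^sup>2 \<le> ?y \<bullet> x" and "?y \<bullet> x \<le> \<beta> * (norm ?y)\<^sup>2"
    using b[of ?y] by (simp_all add: Cy inner_commute)
  have "\<alpha> * (norm ?y)\<^sup>2 \<le> norm ?y * norm x" using lo norm_cauchy_schwarz[of ?y x] by linarith
  then have "\<alpha> * norm ?y \<le> norm x"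
    by (cases "norm ?y = 0") (auto simp: power2_eq_square mult_le_cancel_left mult.left_commute[of \<alpha>])
  then have "norm ?y * norm x \<le> (norm x / \<alpha>) * norm x"
    using C(2) by (intro mult_right_mono) (auto simp: field_simps)
  then show "?y \<bullet> x \<le> (1/\<alpha>) * (norm x)\<^sup>2"
    using norm_cauchy_schwarz[of ?y x] by (simp add: power2_eq_square)
  have "0 \<le> (C *v z) \<bullet> z" for z
    using b(1)[of z] C(2) by (smt (verit) mult_nonneg_nonneg zero_le_power2)
  then have "(norm (C *v ?y))\<^sup>2 \<le> \<beta> * ((C *v ?y) \<bullet> ?y)"
    using coeff_ok_le[OF C(1)] C(2) b
    by (intro norm_square_le_form) (auto simp: coeff_ok_symmetric[OF C(1)])
  then show "(norm x)\<^sup>2 \<le> \<beta> * (?y \<bullet> x)" by (simp add: Cy inner_commute)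
qed

lemma norm_cross3_le:
  assumes "norm i = 1"
  shows "norm (cross3 i x) \<le> norm x"
proof -
  have "(norm (cross3 i x))\<^sup>2 \<le> (norm x)\<^sup>2" using norm_cross[of i x] assms by simp
  then show ?thesis by (rule power2_le_imp_le) simp
qed

section \<open>The compliance operator of an edge\<close>

lemma linear_compliance: "linear (compliance h i P Q)"
  by (rule linearI)
    (simp_all add: compliance_def cross_add_right cross_mult_right matrix_vector_right_distrib
      matrix_vector_mult_scaleR algebra_simps)

lemma compliance_inner:
  "compliance h i P Q x \<bullet> y = (P *v x) \<bullet> y + (h\<^sup>2/12) * ((Q *v cross3 i x) \<bullet> cross3 i y)"
  by (simp add: compliance_def inner_diff_left cross3_inner_cyclic)

text \<open>\<open>S\<close> adds to the inverse of \<open>Cn\<close> a nonnegative symmetric term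
  of weight \<open>h\<^sup>2/12\<close>. It inherits the lower bound from the former and has an
  upper bound free of \<open>h\<close>; bounds on the norm of \<open>S x\<close> follow from
  symmetry.\<close>

lemma compliance_bounds:
  assumes Cn: "coeff_ok Cn \<alpha>n \<beta>n" "0 < \<alpha>n" and Cm: "coeff_ok Cm \<alpha>m \<beta>m" "0 < \<alpha>m"
    and i: "norm i = 1" and h: "0 \<le> h" "h \<le> 1"
  defines "S \<equiv> compliance h i (matrix_inv Cn) (matrix_inv Cm)"
  shows "(norm x)\<^sup>2 \<le> \<beta>n * (S x \<bullet> x)"
    and "(norm (S x))\<^sup>2 \<le> (1/\<alpha>n + 1/\<alpha>m) * (S x \<bullet> x)"
    and "S x \<bullet> x \<le> \<beta>n * (norm (S x))\<^sup>2"
proof -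
  let ?P = "matrix_inv Cn" and ?Q = "matrix_inv Cm"
  have \<beta>: "0 < \<beta>n" using coeff_ok_le[OF Cn(1)] Cn(2) by simp
  have Q0: "0 \<le> (?Q *v z) \<bullet> z" for z
    using inverse_coeff_bounds(1)[OF Cm, of z] Cm(2) by (smt (verit) mult_nonneg_nonneg zero_le_power2)
  have PS: "(?P *v z) \<bullet> z \<le> S z \<bullet> z" for z
    using Q0[of "cross3 i z"] by (simp add: S_def compliance_inner)
  have lower: "(norm z)\<^sup>2 \<le> \<beta>n * (S z \<bullet> z)" for z
    using inverse_coeff_bounds(4)[OF Cn, of z] mult_left_mono[OF PS[of z], of \<beta>n] \<beta> by linarith
  then show "(norm x)\<^sup>2 \<le> \<beta>n * (S x \<bullet> x)" .
  \<comment> \<open>The bound on the edge length enters here: it keeps the weight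
    \<open>h\<^sup>2/12\<close> below \<open>1\<close>.\<close>
  have upper: "S z \<bullet> z \<le> (1/\<alpha>n + 1/\<alpha>m) * (norm z)\<^sup>2" for z
  proof -
    have "h\<^sup>2 \<le> 1" using h by (simp add: power_le_one)
    then have "(h\<^sup>2/12) * ((?Q *v cross3 i z) \<bullet> cross3 i z) \<le> 1 * ((?Q *v cross3 i z) \<bullet> cross3 i z)"
      using Q0 by (intro mult_right_mono) auto
    also have "\<dots> \<le> (1/\<alpha>m) * (norm (cross3 i z))\<^sup>2"
      using inverse_coeff_bounds(3)[OF Cm, of "cross3 i z"] by simp
    also have "\<dots> \<le> (1/\<alpha>m) * (norm z)\<^sup>2"
      using norm_cross3_le[OF i, of z] Cm(2) by (intro mult_left_mono power_mono) auto
    finally show ?thesis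
      using inverse_coeff_bounds(3)[OF Cn, of z] unfolding S_def compliance_inner distrib_right by linarith
  qed
  have sym: "S y \<bullet> z = y \<bullet> S z" for y z
    unfolding S_def inner_commute[of y "compliance _ _ _ _ z"] compliance_inner
    using inverse_coeff_symmetric[OF Cn, of y z] inverse_coeff_symmetric[OF Cm, of "cross3 i y" "cross3 i z"]
    by (simp add: inner_commute)
  have pos: "0 \<le> S z \<bullet> z" for z
    using order_trans[OF zero_le_power2 lower[of z]] \<beta> by (simp add: zero_le_mult_iff)
  show "(norm (S x))\<^sup>2 \<le> (1/\<alpha>n + 1/\<alpha>m) * (S x \<bullet> x)"
    using Cn(2) Cm(2)
    by (intro norm_square_le_form sym pos upper add_pos_pos) (auto simp: S_def linear_compliance)
  \<comment> \<open>Cauchy-Schwarz followed by the lower bound for \<open>x\<close>; one factor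
    \<open>S x \<bullet> x\<close> then cancels, the case where it is zero being trivial.\<close>
  have "(S x \<bullet> x)\<^sup>2 \<le> (norm (S x) * norm x)\<^sup>2"
    using norm_cauchy_schwarz[of "S x" x] pos[of x] by (intro power_mono)
  also have "\<dots> \<le> (norm (S x))\<^sup>2 * (\<beta>n * (S x \<bullet> x))"
    unfolding power_mult_distrib by (intro mult_left_mono lower) simp
  finally have "(S x \<bullet> x) * (S x \<bullet> x) \<le> (\<beta>n * (norm (S x))\<^sup>2) * (S x \<bullet> x)"
    by (simp add: power2_eq_square mult_ac)
  then show "S x \<bullet> x \<le> \<beta>n * (norm (S x))\<^sup>2"
    using pos[of x] \<beta> by (cases "S x \<bullet> x = 0") (auto simp: mult_le_cancel_right)
qed


section \<open>Energy of an edge against its stiffness and mass terms\<close>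

lemma power2_norm_add_le:
  fixes x y :: "'a::real_inner"
  shows "(norm (x + y))\<^sup>2 \<le> 2 * (norm x)\<^sup>2 + 2 * (norm y)\<^sup>2"
proof -
  have "0 \<le> (norm (x - y))\<^sup>2" by simp
  then show ?thesis
    by (simp add: power2_norm_eq_inner inner_add_left inner_add_right inner_diff_left inner_diff_right inner_commute)
qed

text \<open>\<open>E\<close> is the contribution of the edge to \<open>A\<close>, \<open>D\<close>
  and \<open>R\<close> those of displacement and rotation to \<open>L\<close>, and \<open>W\<close>
  twice that of rotation to \<open>M\<close>. The energy equals
  \<open>h * (g \<bullet> n0) + h * (y \<bullet> m0)\<close>: the second term is comparable to
  \<open>R\<close>, the first to \<open>h * (norm g)\<^sup>2\<close>, which differs from
  \<open>D\<close> by factors of two and multiples of \<open>W\<close>.\<close>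

lemma edge_energy_bounds:
  fixes ua ub ra rb n0 m0 :: vec3
  assumes Cn: "coeff_ok Cn \<alpha>n \<beta>n" "0 < \<alpha>n" and Cm: "coeff_ok Cm \<alpha>m \<beta>m" "0 < \<alpha>m"
    and i: "norm i = 1" and h: "0 < h" "h \<le> 1"
    and eqm: "h *\<^sub>R (matrix_inv Cm *v m0) = ra - rb"
    and eqn: "h *\<^sub>R compliance h i (matrix_inv Cn) (matrix_inv Cm) n0 = ua - ub - (h/2) *\<^sub>R cross3 i (ra + rb)"
  defines "k \<equiv> cross3 i n0"
  defines "E \<equiv> - (n0 \<bullet> (ub - ua) + (m0 - (h/2) *\<^sub>R k) \<bullet> rb - (m0 + (h/2) *\<^sub>R k) \<bullet> ra)"
    and "D \<equiv> (norm (ua - ub))\<^sup>2 / h" and "R \<equiv> (norm (ra - rb))\<^sup>2 / h"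
    and "W \<equiv> h * ((norm ra)\<^sup>2 + (norm rb)\<^sup>2)"
  shows "\<alpha>m * R \<le> E"
    and "D \<le> 2 * (1/\<alpha>n + 1/\<alpha>m) * E + W"
    and "E \<le> \<beta>n * (2 * D + W) + \<beta>m * R"
proof -
  define g where "g = compliance h i (matrix_inv Cn) (matrix_inv Cm) n0"
  define y where "y = matrix_inv Cm *v m0"
  define s where "s = cross3 i (ra + rb)"
  note S = compliance_bounds[OF Cn Cm i order.strict_implies_order[OF h(1)] h(2), of n0, folded g_def]
  have D: "ua - ub = h *\<^sub>R g + (h/2) *\<^sub>R s" using eqn by (simp add: g_def s_def)
  have R: "ra - rb = h *\<^sub>R y" using eqm by (simp add: y_def)
  have E: "E = h * (g \<bullet> n0) + h * (y \<bullet> m0)"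
  proof -
    have "E = (ua - ub) \<bullet> n0 + (ra - rb) \<bullet> m0 + (h/2) * (k \<bullet> (ra + rb))"
      by (simp add: E_def inner_diff_left inner_diff_right inner_add_left inner_add_right inner_commute algebra_simps)
    \<comment> \<open>The drop of the moment along the edge cancels the rotation part of the
      displacement difference, leaving a sum of two nonnegative forms.\<close>
    also have "k \<bullet> (ra + rb) = - (s \<bullet> n0)"
      by (simp add: k_def s_def cross3_inner_cyclic inner_commute)
    finally show ?thesis by (simp add: D R inner_add_left)
  qed
  have R': "R = h * (norm y)\<^sup>2" using h by (simp add: R_def R power2_eq_square)
  have m: "\<alpha>m * R \<le> h * (y \<bullet> m0)" "h * (y \<bullet> m0) \<le> \<beta>m * R"
    using mult_left_mono[OF inverse_coeff_bounds(1)[OF Cm, of m0], of h]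
      mult_left_mono[OF inverse_coeff_bounds(2)[OF Cm, of m0], of h] h(1)
    by (simp_all add: R' y_def mult_ac)
  have gn: "0 \<le> g \<bullet> n0" using S(1) coeff_ok_le[OF Cn(1)] Cn(2)
    by (smt (verit) zero_le_power2 mult_neg_neg mult_pos_neg)
  have R0: "0 \<le> R" using h by (simp add: R')
  have y0: "0 \<le> h * (y \<bullet> m0)" using m(1) R0 Cm(2) by (smt (verit) mult_nonneg_nonneg)
  show "\<alpha>m * R \<le> E" using m(1) mult_nonneg_nonneg[OF less_imp_le[OF h(1)] gn] unfolding E by linarith
  have s: "(norm s)\<^sup>2 \<le> 2 * (norm ra)\<^sup>2 + 2 * (norm rb)\<^sup>2"
    unfolding s_def
    by (rule order_trans[OF power_mono[OF norm_cross3_le[OF i]] power2_norm_add_le]) simp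
  \<comment> \<open>The factor \<open>h/2\<close> squared and divided by \<open>h\<close> leaves
    \<open>h/4\<close>; doubled by the square of a sum it is the \<open>h/2\<close> here.\<close>
  have hs: "h/2 * (norm s)\<^sup>2 \<le> W"
    using mult_left_mono[OF s, of "h/2"] h(1) by (simp add: W_def algebra_simps)
  have "(norm (ua - ub))\<^sup>2 \<le> 2 * (norm (h *\<^sub>R g))\<^sup>2 + 2 * (norm ((h/2) *\<^sub>R s))\<^sup>2"
    unfolding D by (rule power2_norm_add_le)
  then have "D \<le> (2 * (norm (h *\<^sub>R g))\<^sup>2 + 2 * (norm ((h/2) *\<^sub>R s))\<^sup>2) / h"
    unfolding D_def using h(1) by (intro divide_right_mono) auto
  also have "\<dots> = 2 * (h * (norm g)\<^sup>2) + h/2 * (norm s)\<^sup>2"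
    using h(1) by (simp add: field_simps power2_eq_square)
  finally have D1: "D \<le> 2 * (h * (norm g)\<^sup>2) + W" using hs by linarith
  have "(norm (h *\<^sub>R g))\<^sup>2 \<le> 2 * (norm (ua - ub))\<^sup>2 + 2 * (norm (- ((h/2) *\<^sub>R s)))\<^sup>2"
    using power2_norm_add_le[of "ua - ub" "- ((h/2) *\<^sub>R s)"] by (simp add: D)
  then have "(norm (h *\<^sub>R g))\<^sup>2 / h \<le> (2 * (norm (ua - ub))\<^sup>2 + 2 * (norm (- ((h/2) *\<^sub>R s)))\<^sup>2) / h"
    using h(1) by (intro divide_right_mono) auto
  also have "\<dots> = 2 * D + h/2 * (norm s)\<^sup>2"
    unfolding D_def using h(1) by (simp add: field_simps power2_eq_square)
  also have "(norm (h *\<^sub>R g))\<^sup>2 / h = h * (norm g)\<^sup>2"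
    using h(1) by (simp add: field_simps power2_eq_square)
  finally have D2: "h * (norm g)\<^sup>2 \<le> 2 * D + W" using hs by linarith
  have "h * (norm g)\<^sup>2 \<le> (1/\<alpha>n + 1/\<alpha>m) * (h * (g \<bullet> n0))"
    using mult_left_mono[OF S(2), of h] h(1) by (simp add: mult_ac)
  also have "\<dots> \<le> (1/\<alpha>n + 1/\<alpha>m) * E"
    using y0 Cn(2) Cm(2) by (intro mult_left_mono) (auto simp: E)
  finally show "D \<le> 2 * (1/\<alpha>n + 1/\<alpha>m) * E + W" using D1 by linarith
  have "h * (g \<bullet> n0) \<le> \<beta>n * (h * (norm g)\<^sup>2)"
    using mult_left_mono[OF S(3), of h] h(1) by (simp add: mult_ac)
  also have "\<dots> \<le> \<beta>n * (2 * D + W)"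
    using coeff_ok_le[OF Cn(1)] Cn(2) by (intro mult_left_mono D2) auto
  finally show "E \<le> \<beta>n * (2 * D + W) + \<beta>m * R" using m(2) by (simp add: E)
qed

text \<open>The definite description in \<open>NM_at\<close> needs both existence and uniqueness of
  the traces. Injectivity of \<open>S\<close> and of the inverse of \<open>Cm\<close> gives unique
  \<open>n0\<close> and \<open>m0\<close>; every solution is affine and satisfies the same two
  equations.\<close>

lemma NM_at_exists:
  assumes Cn: "coeff_ok (Cn e) \<alpha>n \<beta>n" "0 < \<alpha>n" and Cm: "coeff_ok (Cm e) \<alpha>m \<beta>m" "0 < \<alpha>m"
    and e: "fst e \<noteq> snd e" and h1: "edge_len e \<le> 1"
  defines "h \<equiv> edge_len e" and "i \<equiv> edge_dir e"
  obtains n0 m0 where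
    "h *\<^sub>R (matrix_inv (Cm e) *v m0) = phi (fst e) - phi (snd e)"
    "h *\<^sub>R compliance h i (matrix_inv (Cn e)) (matrix_inv (Cm e)) n0 =
      lam (fst e) - lam (snd e) - (h/2) *\<^sub>R cross3 i (phi (fst e) + phi (snd e))"
    "\<And>t. t \<in> {0..h} \<Longrightarrow> NM_at Cn Cm e lam phi t = (n0, m0 - (t - h/2) *\<^sub>R cross3 i n0)"
proof -
  have h: "0 < h" using e by (simp add: h_def edge_len_def)
  have i: "norm i = 1" using h by (simp add: i_def edge_dir_def h_def edge_len_def)
  let ?P = "matrix_inv (Cn e)" and ?Q = "matrix_inv (Cm e)"
  define S where "S = compliance h i ?P ?Q"
  have "inj S"
  proof -
    have "x = 0" if "S x = 0" for x
      using compliance_bounds(1)[OF Cn Cm i, of h x] that h h1 by (simp add: S_def h_def)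
    then show ?thesis
      using linear_injective_0[of S] linear_compliance[of h i ?P ?Q] by (simp add: S_def)
  qed
  then have "surj S" using linear_injective_imp_surjective linear_compliance S_def by blast
  have injQ: "x = y" if "?Q *v x = ?Q *v y" for x y using coeff_ok_inverse(1)[OF Cm] that by metis
  define rhs where "rhs = lam (fst e) - lam (snd e) - (h/2) *\<^sub>R cross3 i (phi (fst e) + phi (snd e))"
  obtain n0 where "S n0 = (1/h) *\<^sub>R rhs" using \<open>surj S\<close> by (metis surjD)
  then have n0: "h *\<^sub>R S n0 = rhs" using h by simp
  define m0 where "m0 = (1/h) *\<^sub>R (Cm e *v (phi (fst e) - phi (snd e)))"
  have m0: "h *\<^sub>R (?Q *v m0) = phi (fst e) - phi (snd e)"
    using h coeff_ok_inverse(2)[OF Cm] by (simp add: m0_def matrix_vector_mult_scaleR)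
  let ?sol = "local_sol h i (Cn e) (Cm e) (lam (fst e)) (lam (snd e)) (phi (fst e)) (phi (snd e))"
  obtain u r where ex: "?sol u r (\<lambda>_. n0) (\<lambda>x. m0 - (x - h/2) *\<^sub>R cross3 i n0)"
    using local_sol_exists[OF order.strict_implies_order[OF h] m0 n0[unfolded S_def rhs_def]] by blast
  have "n t = n0 \<and> m t = m0 - (t - h/2) *\<^sub>R cross3 i n0" if sol: "?sol u r n m" and t: "t \<in> {0..h}" for u r n m t
  proof -
    define c where "c = n 0"
    \<comment> \<open>\<open>d\<close> is the moment at the midpoint; recentring there matches the
      form expected by \<open>local_sol_equations\<close>.\<close>
    define d where "d = m 0 - (h/2) *\<^sub>R cross3 i c"
    have n: "n x = c" and m: "m x = d - (x - h/2) *\<^sub>R cross3 i c" if "x \<in> {0..h}" for x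
      using local_sol_imp_affine[OF order.strict_implies_order[OF h] sol that]
      by (auto simp: c_def d_def algebra_simps)
    note eqs = local_sol_equations[OF order.strict_implies_order[OF h] sol n m]
    have "h *\<^sub>R S c = h *\<^sub>R S n0" using eqs(2) n0 by (simp add: S_def rhs_def)
    then have "c = n0" using h \<open>inj S\<close> by (simp add: inj_eq)
    moreover have "h *\<^sub>R (?Q *v d) = h *\<^sub>R (?Q *v m0)" using eqs(1) m0 by simp
    then have "d = m0" using h injQ by simp
    ultimately show ?thesis using n[OF t] m[OF t] by simp
  qed
  then have "NM_at Cn Cm e lam phi t = (n0, m0 - (t - h/2) *\<^sub>R cross3 i n0)" if "t \<in> {0..h}" for t
    unfolding NM_at_def h_def[symmetric] i_def[symmetric] using ex that
    by (intro the_equality) blast+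
  then show thesis using that m0 n0 by (simp add: S_def rhs_def)
qed

section \<open>Summation over the graph\<close>

text \<open>Double counting: without loops, an edge is incident to exactly two distinct
  nodes.\<close>

lemma sum_incident:
  fixes F :: "edge \<Rightarrow> vec3 \<Rightarrow> 'a::comm_monoid_add"
  assumes N: "finite N" and E: "E \<subseteq> N \<times> N" and loop: "\<forall>e\<in>E. fst e \<noteq> snd e"
  shows "(\<Sum>nd\<in>N. \<Sum>e\<in>{e\<in>E. fst e = nd \<or> snd e = nd}. F e nd) = (\<Sum>e\<in>E. F e (fst e) + F e (snd e))"
proof -
  have "finite E" using N E finite_subset by blast
  then have "(\<Sum>nd\<in>N. \<Sum>e\<in>{e\<in>E. fst e = nd \<or> snd e = nd}. F e nd) =
      (\<Sum>e\<in>E. \<Sum>nd\<in>{nd\<in>N. fst e = nd \<or> snd e = nd}. F e nd)"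
    by (rule sum.swap_restrict[OF N])
  also have "\<dots> = (\<Sum>e\<in>E. F e (fst e) + F e (snd e))"
  proof (rule sum.cong[OF refl])
    fix e assume e: "e \<in> E"
    then have "{nd\<in>N. fst e = nd \<or> snd e = nd} = {fst e, snd e}" using E by auto
    then show "(\<Sum>nd\<in>{nd\<in>N. fst e = nd \<or> snd e = nd}. F e nd) = F e (fst e) + F e (snd e)"
      using bspec[OF loop e] by simp
  qed
  finally show ?thesis .
qed

text \<open>An edge is seen from both ends with weight \<open>1/2\<close> and differences of
  opposite sign, so it is counted once.\<close>

lemma stiffL_edges:
  assumes "finite N" and "E \<subseteq> N \<times> N" and loop: "\<forall>e\<in>E. fst e \<noteq> snd e"
  shows "stiffL N E mu mu = (\<Sum>e\<in>E. (norm (mu (fst e) - mu (snd e)))\<^sup>2 / edge_len e)"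
proof -
  have "stiffL N E mu mu = (\<Sum>nd\<in>N. \<Sum>e\<in>{e\<in>E. fst e = nd \<or> snd e = nd}.
      (1/2) * ((norm (mu nd - mu (other_end e nd)))\<^sup>2 / edge_len e))"
    by (simp add: stiffL_def sum_distrib_left power2_norm_eq_inner)
  also have "\<dots> = (\<Sum>e\<in>E. (norm (mu (fst e) - mu (snd e)))\<^sup>2 / edge_len e)"
    unfolding sum_incident[OF assms]
    using loop by (intro sum.cong) (auto simp: other_end_def norm_minus_commute)
  finally show ?thesis .
qed

lemma massM_edges:
  assumes "finite N" and "E \<subseteq> N \<times> N" and "\<forall>e\<in>E. fst e \<noteq> snd e"
  shows "massM N E mu mu = (1/2) * (\<Sum>e\<in>E. edge_len e * ((norm (mu (fst e)))\<^sup>2 + (norm (mu (snd e)))\<^sup>2))"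
proof -
  have "massM N E mu mu = (\<Sum>nd\<in>N. \<Sum>e\<in>{e\<in>E. fst e = nd \<or> snd e = nd}.
      (1/2) * (edge_len e * (norm (mu nd))\<^sup>2))"
    by (simp add: massM_def sum_distrib_left sum_distrib_right power2_norm_eq_inner mult.assoc)
  also have "\<dots> = (\<Sum>e\<in>E. (1/2) * (edge_len e * (norm (mu (fst e)))\<^sup>2) + (1/2) * (edge_len e * (norm (mu (snd e)))\<^sup>2))"
    by (rule sum_incident[OF assms])
  also have "\<dots> = (1/2) * (\<Sum>e\<in>E. edge_len e * ((norm (mu (fst e)))\<^sup>2 + (norm (mu (snd e)))\<^sup>2))"
    by (simp add: sum_distrib_left distrib_left)
  finally show ?thesis .
qed

text \<open>The test functions vanish on \<open>ND\<close>, so the nodal sum may be extended to all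
  of \<open>N\<close> and then regrouped by edges.\<close>

lemma bilinA_edges:
  assumes "finite N" and "E \<subseteq> N \<times> N" and loop: "\<forall>e\<in>E. fst e \<noteq> snd e"
    and D: "inV ND mu" "inV ND psi"
  shows "bilinA Cn Cm N E ND lam phi mu psi =
    (\<Sum>e\<in>E. - (fst (NM_at Cn Cm e lam phi (edge_len e)) \<bullet> mu (snd e) - fst (NM_at Cn Cm e lam phi 0) \<bullet> mu (fst e)
      + snd (NM_at Cn Cm e lam phi (edge_len e)) \<bullet> psi (snd e) - snd (NM_at Cn Cm e lam phi 0) \<bullet> psi (fst e)))"
proof -
  define F where "F e nd =
    (if fst e = nd then - fst (NM_at Cn Cm e lam phi 0) else fst (NM_at Cn Cm e lam phi (edge_len e))) \<bullet> mu nd +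
    (if fst e = nd then - snd (NM_at Cn Cm e lam phi 0) else snd (NM_at Cn Cm e lam phi (edge_len e))) \<bullet> psi nd"
    for e nd
  have "bilinA Cn Cm N E ND lam phi mu psi =
      - (\<Sum>nd\<in>N. jumpN Cn Cm E lam phi nd \<bullet> mu nd + jumpM Cn Cm E lam phi nd \<bullet> psi nd)"
    unfolding bilinA_def using assms(1) D
    by (subst sum.mono_neutral_left[of N "N - ND"]) (auto simp: inV_def)
  also have "(\<Sum>nd\<in>N. jumpN Cn Cm E lam phi nd \<bullet> mu nd + jumpM Cn Cm E lam phi nd \<bullet> psi nd) =
      (\<Sum>nd\<in>N. \<Sum>e\<in>{e\<in>E. fst e = nd \<or> snd e = nd}. F e nd)"
    by (simp add: jumpN_def jumpM_def F_def inner_sum_left sum.distrib)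
  also have "\<dots> = (\<Sum>e\<in>E. F e (fst e) + F e (snd e))"
    by (rule sum_incident[OF assms(1-3)])
  also have "- \<dots> = (\<Sum>e\<in>E. - (F e (fst e) + F e (snd e)))"
    by (rule sum_negf[symmetric])
  also have "\<dots> = (\<Sum>e\<in>E. - (fst (NM_at Cn Cm e lam phi (edge_len e)) \<bullet> mu (snd e) - fst (NM_at Cn Cm e lam phi 0) \<bullet> mu (fst e)
      + snd (NM_at Cn Cm e lam phi (edge_len e)) \<bullet> psi (snd e) - snd (NM_at Cn Cm e lam phi 0) \<bullet> psi (fst e)))"
    using loop by (intro sum.cong) (auto simp: F_def)
  finally show ?thesis .
qed

section \<open>Discrete Poincare inequality and positivity of the smallest quotient\<close>

lemma nodal_value_le_stiffL:
  assumes N: "finite N" and E: "E \<subseteq> N \<times> N" and loop: "\<forall>e\<in>E. fst e \<noteq> snd e"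
    and path: "(d, x) \<in> (E \<union> E\<inverse>)\<^sup>*"
  shows "\<exists>c\<ge>0. \<forall>mu. mu d = 0 \<longrightarrow> (norm (mu x))\<^sup>2 \<le> c * stiffL N E mu mu"
  using path
proof (induction rule: rtrancl_induct)
  case base
  then show ?case by (intro exI[of _ 0]) auto
next
  case (step y z)
  then obtain c where c: "0 \<le> c" "\<And>mu. mu d = 0 \<Longrightarrow> (norm (mu y))\<^sup>2 \<le> c * stiffL N E mu mu" by blast
  obtain e where e: "e \<in> E" "e = (y, z) \<or> e = (z, y)" using step by auto
  have len: "0 < edge_len f" if "f \<in> E" for f using bspec[OF loop that] by (simp add: edge_len_def)
  \<comment> \<open>One more edge on the path from \<open>d\<close>: the squared increment of
    \<open>mu\<close> is at most \<open>edge_len e\<close> times a single summand of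
    \<open>stiffL\<close>, and squaring the sum doubles both parts.\<close>
  have "(norm (mu z))\<^sup>2 \<le> (2 * c + 2 * edge_len e) * stiffL N E mu mu" if "mu d = 0" for mu
  proof -
    have "finite E" using N E finite_subset by blast
    then have "(norm (mu (fst e) - mu (snd e)))\<^sup>2 / edge_len e \<le> stiffL N E mu mu"
      unfolding stiffL_edges[OF N E loop] using len e(1)
      by (intro member_le_sum) (auto intro: divide_nonneg_pos)
    then have "(norm (mu z - mu y))\<^sup>2 \<le> edge_len e * stiffL N E mu mu"
      using len[OF e(1)] e(2) by (auto simp: norm_minus_commute field_simps)
    moreover have "(norm (mu z))\<^sup>2 \<le> 2 * (norm (mu y))\<^sup>2 + 2 * (norm (mu z - mu y))\<^sup>2"
      using power2_norm_add_le[of "mu y" "mu z - mu y"] by simp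
    ultimately show ?thesis using c(2)[of mu, OF that] by (simp add: distrib_right)
  qed
  then show ?case using c(1) len[OF e(1)] by (intro exI[of _ "2 * c + 2 * edge_len e"]) auto
qed

text \<open>The constant depends on the graph; it serves only to show that \<open>lam_min\<close> is
  positive and does not enter the final estimate.\<close>

lemma discrete_poincare:
  assumes N: "finite N" and E: "E \<subseteq> N \<times> N" and loop: "\<forall>e\<in>E. fst e \<noteq> snd e"
    and conn: "\<forall>x\<in>N. (d, x) \<in> (E \<union> E\<inverse>)\<^sup>*"
  shows "\<exists>c>0. \<forall>mu. mu d = 0 \<longrightarrow> massM N E mu mu \<le> c * stiffL N E mu mu"
proof -
  have "\<forall>x\<in>N. \<exists>c\<ge>0. \<forall>mu. mu d = 0 \<longrightarrow> (norm (mu x))\<^sup>2 \<le> c * stiffL N E mu mu"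
    using nodal_value_le_stiffL[OF N E loop] conn by blast
  then obtain c where c: "\<And>x. x \<in> N \<Longrightarrow> 0 \<le> c x"
      "\<And>x mu. x \<in> N \<Longrightarrow> mu d = 0 \<Longrightarrow> (norm (mu x))\<^sup>2 \<le> c x * stiffL N E mu mu"
    by metis
  define C where "C = (\<Sum>e\<in>E. edge_len e * (c (fst e) + c (snd e)))"
  have len: "0 \<le> edge_len e" for e by (simp add: edge_len_def)
  have in_N: "fst e \<in> N" "snd e \<in> N" if "e \<in> E" for e using E that by auto
  have "0 \<le> C" unfolding C_def using c(1) len in_N by (intro sum_nonneg mult_nonneg_nonneg add_nonneg_nonneg) auto
  \<comment> \<open>The summand \<open>1\<close> keeps the constant positive even if
    \<open>C\<close> is zero.\<close>
  have "massM N E mu mu \<le> (1 + C) * stiffL N E mu mu" if mu: "mu d = 0" for mu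
  proof -
    have L0: "0 \<le> stiffL N E mu mu"
      unfolding stiffL_edges[OF N E loop] using len by (intro sum_nonneg divide_nonneg_nonneg) auto
    have "(\<Sum>e\<in>E. edge_len e * ((norm (mu (fst e)))\<^sup>2 + (norm (mu (snd e)))\<^sup>2)) \<le>
        (\<Sum>e\<in>E. edge_len e * (c (fst e) * stiffL N E mu mu + c (snd e) * stiffL N E mu mu))"
      using c(2)[of _ mu] mu len in_N by (intro sum_mono mult_left_mono add_mono) auto
    also have "\<dots> = C * stiffL N E mu mu"
      by (simp add: C_def sum_distrib_right distrib_right mult.assoc)
    finally have "massM N E mu mu \<le> (1/2) * (C * stiffL N E mu mu)"
      unfolding massM_edges[OF N E loop] by simp
    also have "\<dots> \<le> (1 + C) * stiffL N E mu mu"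
      using mult_nonneg_nonneg[OF \<open>0 \<le> C\<close> L0] L0 by (simp add: distrib_right)
    finally show ?thesis .
  qed
  then show ?thesis using \<open>0 \<le> C\<close> by (intro exI[of _ "1 + C"]) auto
qed

text \<open>\<open>mu\<close> vanishes at \<open>d\<close>, so \<open>x\<close> differs from
  \<open>d\<close> and the path reaching it ends with an edge of positive length at
  \<open>x\<close>. Hence the quotients in \<open>lam_min\<close> have positive
  denominators.\<close>

lemma massM_pos:
  assumes N: "finite N" and E: "E \<subseteq> N \<times> N" and loop: "\<forall>e\<in>E. fst e \<noteq> snd e"
    and conn: "\<forall>x\<in>N. (d, x) \<in> (E \<union> E\<inverse>)\<^sup>*" and mu: "mu d = 0" "x \<in> N" "mu x \<noteq> 0"
  shows "0 < massM N E mu mu"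
proof -
  obtain y where "(y, x) \<in> E \<union> E\<inverse>"
    using bspec[OF conn mu(2)] mu by (metis rtranclE)
  then obtain e where e: "e \<in> E" "fst e = x \<or> snd e = x" by auto
  have "finite E" using N E finite_subset by blast
  moreover have "0 < edge_len e * ((norm (mu (fst e)))\<^sup>2 + (norm (mu (snd e)))\<^sup>2)"
    using e mu(3) bspec[OF loop e(1)] by (intro mult_pos_pos) (auto simp: edge_len_def add_pos_nonneg add_nonneg_pos)
  ultimately have "0 < (\<Sum>e\<in>E. edge_len e * ((norm (mu (fst e)))\<^sup>2 + (norm (mu (snd e)))\<^sup>2))"
    using e(1) by (intro sum_pos2) (auto simp: edge_len_def)
  then show ?thesis unfolding massM_edges[OF N E loop] by simp
qed

lemma stiffL_nonneg:
  assumes "finite N" and "E \<subseteq> N \<times> N" and "\<forall>e\<in>E. fst e \<noteq> snd e"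
  shows "0 \<le> stiffL N E mu mu"
  unfolding stiffL_edges[OF assms] by (intro sum_nonneg divide_nonneg_nonneg) (auto simp: edge_len_def)

lemma lam_min_poincare:
  assumes N: "finite N" and E: "E \<subseteq> N \<times> N" and loop: "\<forall>e\<in>E. fst e \<noteq> snd e"
    and d: "d \<in> ND" and conn: "\<forall>x\<in>N. (d, x) \<in> (E \<union> E\<inverse>)\<^sup>*"
    and nu: "inV ND nu" "x \<in> N" "nu x \<noteq> 0" and mu: "inV ND mu"
  shows "0 < lam_min N E ND" and "massM N E mu mu \<le> (1 / lam_min N E ND) * stiffL N E mu mu"
proof -
  define X where "X = {stiffL N E mu mu / massM N E mu mu | mu. inV ND mu \<and> (\<exists>nd\<in>N. mu nd \<noteq> 0)}"
  have lam: "lam_min N E ND = Inf X" by (simp add: lam_min_def X_def)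
  obtain c where c: "0 < c" "\<And>mu. mu d = 0 \<Longrightarrow> massM N E mu mu \<le> c * stiffL N E mu mu"
    using discrete_poincare[OF N E loop conn] by blast
  have V: "mu d = 0" if "inV ND mu" for mu using that d by (simp add: inV_def)
  have lower: "1 / c \<le> q" if q: "q \<in> X" for q
  proof -
    obtain mu y where mu: "q = stiffL N E mu mu / massM N E mu mu" "mu d = 0" "y \<in> N" "mu y \<noteq> 0"
      using q V unfolding X_def by blast
    have "0 < massM N E mu mu" using massM_pos[OF N E loop conn mu(2-4)] .
    then show ?thesis using c(2)[of mu, OF mu(2)] c(1) by (simp add: mu(1) field_simps)
  qed
  \<comment> \<open>\<open>nu\<close> supplies a quotient, so that \<open>Inf X\<close> is a genuine
    infimum, bounded below by \<open>1 / c\<close>.\<close>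
  have "X \<noteq> {}" using nu unfolding X_def by blast
  then have "1 / c \<le> Inf X" using lower by (intro cInf_greatest)
  then show pos: "0 < lam_min N E ND" using c(1) lam by (smt (verit) divide_pos_pos)
  show "massM N E mu mu \<le> (1 / lam_min N E ND) * stiffL N E mu mu"
  proof (cases "\<exists>y\<in>N. mu y \<noteq> 0")
    case True
    then obtain y where y: "y \<in> N" "mu y \<noteq> 0" by blast
    have "stiffL N E mu mu / massM N E mu mu \<in> X" using mu True unfolding X_def by blast
    then have "Inf X \<le> stiffL N E mu mu / massM N E mu mu"
      using lower by (intro cInf_lower bdd_belowI) auto
    then show ?thesis
      using massM_pos[OF N E loop conn V[OF mu] y] pos by (simp add: lam field_simps)
  next
    case False
    then have "massM N E mu mu = 0" by (simp add: massM_def)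
    then show ?thesis using stiffL_nonneg[OF N E loop] pos by simp
  qed
qed

section \<open>Assembly of the two-sided estimate\<close>

theorem theorem5p1:
  fixes \<alpha>n \<beta>n \<alpha>m \<beta>m :: real
  assumes "0 < \<alpha>n" and "0 < \<alpha>m"
  shows "\<exists>h0 > 0. \<exists>K :: real \<Rightarrow> real.
    \<forall>N E ND Cn Cm.
      beam_graph N E ND Cn Cm \<alpha>n \<beta>n \<alpha>m \<beta>m \<and> (\<forall>e\<in>E. edge_len e \<le> h0) \<longrightarrow>
      (\<forall>lam phi. inV ND lam \<and> inV ND phi \<longrightarrow>
         stiffL N E lam lam + stiffL N E phi phi
           \<le> K (1 / lam_min N E ND) * bilinA Cn Cm N E ND lam phi lam phi \<and>
         bilinA Cn Cm N E ND lam phi lam phi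
           \<le> K (1 / lam_min N E ND) * (stiffL N E lam lam + stiffL N E phi phi))"
proof -
  define c where "c = 1/\<alpha>n + 1/\<alpha>m"
  \<comment> \<open>The first bracket is the constant of the lower bound, the second dominates that
    of the upper one. Absolute values appear because the signs of \<open>\<beta>n\<close> and
    \<open>\<beta>m\<close> are known only once there is an edge, while \<open>K\<close> is fixed
    before the graph.\<close>
  define K where "K t = (2 * c + (2 * t + 1) / \<alpha>m) + (2 * \<bar>\<beta>n\<bar> + 2 * \<bar>\<beta>n\<bar> * t + \<bar>\<beta>m\<bar>)" for t
  have c: "0 < c" using assms by (simp add: c_def add_pos_pos)
  have "stiffL N E lam lam + stiffL N E phi phi
           \<le> K (1 / lam_min N E ND) * bilinA Cn Cm N E ND lam phi lam phi \<and>
         bilinA Cn Cm N E ND lam phi lam phi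
           \<le> K (1 / lam_min N E ND) * (stiffL N E lam lam + stiffL N E phi phi)"
    if graph: "beam_graph N E ND Cn Cm \<alpha>n \<beta>n \<alpha>m \<beta>m" and small: "\<forall>e\<in>E. edge_len e \<le> 1"
      and V: "inV ND lam" "inV ND phi"
    for N E ND Cn Cm lam phi
  proof -
    have N: "finite N" and E: "E \<subseteq> N \<times> N" and loop: "\<forall>e\<in>E. fst e \<noteq> snd e"
      using graph by (auto simp: beam_graph_def)
    obtain d where d: "d \<in> ND" "d \<in> N" using graph unfolding beam_graph_def by blast
    have conn: "\<forall>x\<in>N. (d, x) \<in> (E \<union> E\<inverse>)\<^sup>*"
      using graph d(2) unfolding beam_graph_def by blast
    define en where "en e = - (fst (NM_at Cn Cm e lam phi (edge_len e)) \<bullet> lam (snd e) - fst (NM_at Cn Cm e lam phi 0) \<bullet> lam (fst e)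
      + snd (NM_at Cn Cm e lam phi (edge_len e)) \<bullet> phi (snd e) - snd (NM_at Cn Cm e lam phi 0) \<bullet> phi (fst e))" for e
    define Dl where "Dl e = (norm (lam (fst e) - lam (snd e)))\<^sup>2 / edge_len e" for e
    define Dp where "Dp e = (norm (phi (fst e) - phi (snd e)))\<^sup>2 / edge_len e" for e
    define W where "W e = edge_len e * ((norm (phi (fst e)))\<^sup>2 + (norm (phi (snd e)))\<^sup>2)" for e
    have edge: "\<alpha>m * Dp e \<le> en e \<and> Dl e \<le> 2 * c * en e + W e \<and> en e \<le> \<beta>n * (2 * Dl e + W e) + \<beta>m * Dp e"
      if e: "e \<in> E" for e
    proof -
      have Cn: "coeff_ok (Cn e) \<alpha>n \<beta>n" and Cm: "coeff_ok (Cm e) \<alpha>m \<beta>m"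
        using graph e by (auto simp: beam_graph_def)
      have h: "0 < edge_len e" "edge_len e \<le> 1" using bspec[OF loop e] small e by (auto simp: edge_len_def)
      have i: "norm (edge_dir e) = 1" using h by (simp add: edge_dir_def) (simp add: edge_len_def)
      obtain n0 m0 where eqm: "edge_len e *\<^sub>R (matrix_inv (Cm e) *v m0) = phi (fst e) - phi (snd e)"
        and eqn: "edge_len e *\<^sub>R compliance (edge_len e) (edge_dir e) (matrix_inv (Cn e)) (matrix_inv (Cm e)) n0 =
          lam (fst e) - lam (snd e) - (edge_len e / 2) *\<^sub>R cross3 (edge_dir e) (phi (fst e) + phi (snd e))"
        and NM: "\<And>t. t \<in> {0..edge_len e} \<Longrightarrow>
          NM_at Cn Cm e lam phi t = (n0, m0 - (t - edge_len e / 2) *\<^sub>R cross3 (edge_dir e) n0)"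
        using NM_at_exists[where Cn = Cn and Cm = Cm and e = e, OF Cn assms(1) Cm assms(2) bspec[OF loop e] h(2)] by metis
      have "en e = - (n0 \<bullet> (lam (snd e) - lam (fst e)) + (m0 - (edge_len e / 2) *\<^sub>R cross3 (edge_dir e) n0) \<bullet> phi (snd e)
          - (m0 + (edge_len e / 2) *\<^sub>R cross3 (edge_dir e) n0) \<bullet> phi (fst e))"
        using NM[of 0] NM[of "edge_len e"] h by (simp add: en_def inner_diff_right)
      then show ?thesis
        using edge_energy_bounds[OF Cn assms(1) Cm assms(2) i h eqm eqn] by (simp add: Dl_def Dp_def W_def c_def)
    qed
    let ?A = "bilinA Cn Cm N E ND lam phi lam phi"
    let ?Ll = "stiffL N E lam lam" and ?Lp = "stiffL N E phi phi" and ?M = "massM N E phi phi"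
    have A: "?A = sum en E" unfolding en_def by (rule bilinA_edges[OF N E loop V])
    have Ll: "?Ll = sum Dl E" unfolding Dl_def by (rule stiffL_edges[OF N E loop])
    have Lp: "?Lp = sum Dp E" unfolding Dp_def by (rule stiffL_edges[OF N E loop])
    have M: "2 * ?M = sum W E" unfolding W_def massM_edges[OF N E loop] by simp
    have s1: "\<alpha>m * ?Lp \<le> ?A"
      unfolding A Lp sum_distrib_left using edge by (intro sum_mono) auto
    have s2: "?Ll \<le> 2 * c * ?A + 2 * ?M"
      unfolding A Ll M sum_distrib_left sum.distrib[symmetric] using edge by (intro sum_mono) auto
    have s3: "?A \<le> \<beta>n * (2 * ?Ll + 2 * ?M) + \<beta>m * ?Lp"
      unfolding A Ll Lp M sum_distrib_left sum.distrib[symmetric] using edge by (intro sum_mono) auto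
    have L0: "0 \<le> ?Ll" "0 \<le> ?Lp" by (rule stiffL_nonneg[OF N E loop])+
    have A0: "0 \<le> ?A" using s1 L0(2) assms(2) by (smt (verit) mult_nonneg_nonneg)
    show ?thesis
    \<comment> \<open>If the data vanish on all of \<open>N\<close>, the set defining
      \<open>lam_min\<close> may be empty and its infimum carries no information.\<close>
    proof (cases "\<exists>nd\<in>N. lam nd \<noteq> 0 \<or> phi nd \<noteq> 0")
      case True
      define t where "t = 1 / lam_min N E ND"
      obtain nu x where nu: "inV ND nu" "x \<in> N" "nu x \<noteq> 0" using True V by blast
      note P = lam_min_poincare[OF N E loop d(1) conn nu V(2), folded t_def]
      have t: "0 \<le> t" using P(1) by (simp add: t_def)
      have Lp': "?Lp \<le> ?A / \<alpha>m" using s1 assms(2) by (simp add: field_simps)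
      \<comment> \<open>Absorption of the lower-order rotations: their mass is controlled by their
        stiffness, which \<open>s1\<close> already bounds by \<open>A\<close> alone.\<close>
      have "2 * ?M \<le> 2 * t * ?Lp" using P(2) by simp
      also have "\<dots> \<le> 2 * t * (?A / \<alpha>m)" using Lp' t by (intro mult_left_mono) auto
      finally have "?Ll + ?Lp \<le> (2 * c + (2 * t + 1) / \<alpha>m) * ?A"
        using s2 Lp' by (simp add: field_simps add_divide_distrib)
      also have "\<dots> \<le> K t * ?A" unfolding K_def using t A0 by (intro mult_right_mono) auto
      finally have lower: "?Ll + ?Lp \<le> K t * ?A" .
      have M0: "0 \<le> ?M" unfolding massM_edges[OF N E loop] by (auto simp: edge_len_def intro!: sum_nonneg)
      have "?A \<le> \<bar>\<beta>n\<bar> * (2 * ?Ll + 2 * ?M) + \<bar>\<beta>m\<bar> * ?Lp"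
        using s3 L0 M0 mult_right_mono[OF abs_ge_self[of \<beta>n], of "2 * ?Ll + 2 * ?M"]
          mult_right_mono[OF abs_ge_self[of \<beta>m], of ?Lp] by linarith
      also have "\<dots> \<le> \<bar>\<beta>n\<bar> * (2 * ?Ll + 2 * (t * ?Lp)) + \<bar>\<beta>m\<bar> * ?Lp"
        using P(2) by (intro add_right_mono mult_left_mono) auto
      also have "\<dots> = 2 * \<bar>\<beta>n\<bar> * ?Ll + (2 * \<bar>\<beta>n\<bar> * t + \<bar>\<beta>m\<bar>) * ?Lp" by (simp add: algebra_simps)
      also have "\<dots> \<le> K t * ?Ll + K t * ?Lp"
      proof -
        have "0 \<le> 2 * c + (2 * t + 1) / \<alpha>m" using c t assms(2) by simp
        moreover have "0 \<le> \<bar>\<beta>n\<bar> * t" using t by simp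
        ultimately have "2 * \<bar>\<beta>n\<bar> \<le> K t" "2 * \<bar>\<beta>n\<bar> * t + \<bar>\<beta>m\<bar> \<le> K t" by (auto simp: K_def)
        then show ?thesis using L0 by (intro add_mono mult_right_mono)
      qed
      finally show ?thesis using lower by (simp add: t_def distrib_left)
    next
      case False
      then have z: "lam (fst e) = 0" "lam (snd e) = 0" "phi (fst e) = 0" "phi (snd e) = 0" if "e \<in> E" for e
        using E that by auto
      have "?Ll = 0" "?Lp = 0" "?M = 0"
        unfolding stiffL_edges[OF N E loop] massM_edges[OF N E loop] using z by simp_all
      \<comment> \<open>With all stiffness and mass terms zero, \<open>s3\<close> and
        \<open>A0\<close> force \<open>A\<close> to be zero, so both inequalities hold whatever the
        value of \<open>K\<close>.\<close>
      then show ?thesis using s3 A0 by simp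
    qed
  qed
  then show ?thesis by (intro exI[of _ "1::real"] exI[of _ K] conjI) auto
qed

end
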